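(* Let $E$ be a complex Banach space and consider the following assertions: (a) $E$ does not contain a copy of $\mathrm{c}_0$. (b) Every power-bounded operator $T\in\mathscr{L}(E)$ which is power-bounded below and has relatively compact orbits on $\mathrm{rg}(I-T)$ has relatively compact orbits on $E$. (c) Every power-bounded operator $T\in\mathscr{L}(E)$ which is power-bounded below and has relatively compact orbits on $\mathrm{rg}(I-T)$ is mean ergodic on $E$. (d) Every doubly power-bounded operator $T\in\mathscr{L}(E)$ with relatively compact orbits on $\mathrm{rg}(I-T)$ has relatively compact orbits on $E$. (e) Every doubly power-bounded operator $T\in\mathscr{L}(E)$ with relatively compact orbits on $\mathrm{rg}(I-T)$ is mean ergodic on $E$. Then (a) $\Rightarrow$ (b) $\Leftrightarrow$ (c) $\Rightarrow$ (d) $\Leftrightarrow$ (e). If $E$ is separable, then all the assertions (a)--(e) are equivalent.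
   Context: $\mathscr{L}(E)$ denotes the bounded linear operators on $E$, $I$ the identity operator, and $\mathrm{rg}$ the range. $T\in\mathscr{L}(E)$ is power-bounded if $\sup_{n\in\mathbb{N}}\|T^n\|<\infty$; it is power-bounded below if $\inf_{n\in\mathbb{N}}\|T^nx\|>0$ for every $x\in E\setminus\{0\}$; it is doubly power-bounded if it is invertible and both $T$ and $T^{-1}$ are power-bounded. For a linear subspace $F\subseteq E$, $T$ has relatively compact orbits on $F$ if $\{T^ny\mid n\in\mathbb{N}\}$ is relatively compact in norm for every $y\in F$. A power-bounded operator $T$ is mean ergodic if the semigroup $\mathcal{S}=\{T^n\mid n\in\mathbb{N}\}$ is mean ergodic, i.e., the closed convex hull of $\mathcal{S}$ in the strong operator topology contains a projection $P$ with $PT=TP=P$; equivalently, $E=\ker(I-T)\oplus\overline{\mathrm{rg}(I-T)}$; equivalently, the Cesàro means $\frac1N\sum_{n=0}^{N-1}T^n$ converge in the strong operator topology as $N\to\infty$. $\mathrm{c}_0$ is the Banach space of complex null sequences with the supremum norm; "$E$ contains a copy of $\mathrm{c}_0$" means that some closed subspace of $E$ is linearly homeomorphic to $\mathrm{c}_0$. *)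

theory Defs
  imports "HOL-Analysis.Analysis"
begin

section \<open>Complex normed and Banach spaces\<close>

text \<open>
  The real structure is kept and extended by a compatible complex scalar multiplication, so all
  notions for real normed spaces (norm topology, closure, convex hull, bounded operators and their
  norm) stay available. The unit law follows from \<open>scaleR_scaleC\<close>.
\<close>

class complex_normed_vector = real_normed_vector +
  fixes scaleC :: "complex \<Rightarrow> 'a \<Rightarrow> 'a"  (infixr \<open>*\<^sub>C\<close> 75)
  assumes scaleC_add_right: "c *\<^sub>C (x + y) = c *\<^sub>C x + c *\<^sub>C y"
    and scaleC_add_left: "(c + d) *\<^sub>C x = c *\<^sub>C x + d *\<^sub>C x"
    and scaleC_scaleC: "c *\<^sub>C d *\<^sub>C x = (c * d) *\<^sub>C x"
    and scaleR_scaleC: "r *\<^sub>R x = complex_of_real r *\<^sub>C x"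
    and norm_scaleC: "norm (c *\<^sub>C x) = cmod c * norm x"

class complex_banach = complex_normed_vector + complete_space

subclass (in complex_banach) banach ..

interpretation complex_vector:
  vector_space "scaleC :: complex \<Rightarrow> 'a \<Rightarrow> 'a::complex_normed_vector"
proof
  show "1 *\<^sub>C x = x" for x :: 'a
    by (metis of_real_1 scaleR_one scaleR_scaleC)
qed (simp_all add: scaleC_add_right scaleC_add_left scaleC_scaleC)

instantiation complex :: complex_banach
begin

definition scaleC_complex :: "complex \<Rightarrow> complex \<Rightarrow> complex" where
  "scaleC_complex c z = c * z"

instance
  by standard (simp_all add: scaleC_complex_def distrib_left distrib_right mult.assoc norm_mult scaleR_conv_of_real)

end

lemma bounded_linear_scaleC_right:
  "bounded_linear (\<lambda>x :: 'a::complex_normed_vector. c *\<^sub>C x)"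
proof (rule bounded_linear_intro)
  fix x y :: 'a and r :: real
  show "c *\<^sub>C (x + y) = c *\<^sub>C x + c *\<^sub>C y"
    by (rule scaleC_add_right)
  show "c *\<^sub>C r *\<^sub>R x = r *\<^sub>R c *\<^sub>C x"
    by (simp add: scaleR_scaleC scaleC_scaleC mult.commute)
  show "norm (c *\<^sub>C x) \<le> norm x * cmod c"
    by (simp add: norm_scaleC)
qed

lemma scaleC_in_bcontfun:
  fixes f :: "'a::topological_space \<Rightarrow> 'b::complex_normed_vector"
  assumes "f \<in> bcontfun"
  shows "(\<lambda>x. c *\<^sub>C f x) \<in> bcontfun"
proof -
  have "continuous_on UNIV f" and "bounded (range f)"
    using assms by (auto simp: bcontfun_def)
  moreover have "range (\<lambda>x. c *\<^sub>C f x) = (\<lambda>x. c *\<^sub>C x) ` range f"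
    by auto
  ultimately show ?thesis
    unfolding bcontfun_def
    using bounded_linear_image[OF _ bounded_linear_scaleC_right, of "range f" c]
      bounded_linear.continuous_on[OF bounded_linear_scaleC_right]
    by auto
qed

instantiation bcontfun :: (topological_space, complex_normed_vector) complex_normed_vector
begin

definition scaleC_bcontfun :: "complex \<Rightarrow> ('a \<Rightarrow>\<^sub>C 'b) \<Rightarrow> 'a \<Rightarrow>\<^sub>C 'b" where
  "scaleC_bcontfun c f = Bcontfun (\<lambda>x. c *\<^sub>C apply_bcontfun f x)"

lemma apply_bcontfun_scaleC: "apply_bcontfun (c *\<^sub>C f) x = c *\<^sub>C apply_bcontfun f x"
  for f :: "'a \<Rightarrow>\<^sub>C 'b"
  by (simp add: scaleC_bcontfun_def Bcontfun_inverse scaleC_in_bcontfun[OF apply_bcontfun])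

instance
proof
  fix c d :: complex and r :: real and f g :: "'a \<Rightarrow>\<^sub>C 'b"
  show "c *\<^sub>C (f + g) = c *\<^sub>C f + c *\<^sub>C g"
    by (rule bcontfun_eqI) (simp add: apply_bcontfun_scaleC scaleC_add_right)
  show "(c + d) *\<^sub>C f = c *\<^sub>C f + d *\<^sub>C f"
    by (rule bcontfun_eqI) (simp add: apply_bcontfun_scaleC scaleC_add_left)
  show mult: "c *\<^sub>C d *\<^sub>C f = (c * d) *\<^sub>C f" for c d and f :: "'a \<Rightarrow>\<^sub>C 'b"
    by (rule bcontfun_eqI) (simp add: apply_bcontfun_scaleC scaleC_scaleC)
  show real: "r *\<^sub>R f = complex_of_real r *\<^sub>C f" for r and f :: "'a \<Rightarrow>\<^sub>C 'b"
    by (rule bcontfun_eqI) (simp add: apply_bcontfun_scaleC scaleR_scaleC)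
  have le: "norm (c *\<^sub>C f) \<le> cmod c * norm f" for c and f :: "'a \<Rightarrow>\<^sub>C 'b"
    by (rule norm_bound)
      (simp add: apply_bcontfun_scaleC norm_scaleC mult_left_mono norm_bounded)
  show "norm (c *\<^sub>C f) = cmod c * norm f"
  proof (cases "c = 0")
    case True
    then show ?thesis
      using real[of 0 f] by simp
  next
    case False
    have "inverse c *\<^sub>C c *\<^sub>C f = f"
      using real[of 1 f] False by (simp add: mult)
    then have "norm f \<le> cmod (inverse c) * norm (c *\<^sub>C f)"
      using le[of "inverse c" "c *\<^sub>C f"] by simp
    then have "cmod c * norm f \<le> norm (c *\<^sub>C f)"
      using False unfolding norm_inverse by (simp add: divide_simps mult.commute)
    with le[of c f] show ?thesis
      by simp
  qed
qed

end

section \<open>Copies of the space of null sequences\<close>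

text \<open>
  \<^typ>\<open>nat\<close> carries the discrete topology, so \<^typ>\<open>nat \<Rightarrow>\<^sub>C complex\<close> is the space of all bounded
  complex sequences with the supremum norm.
\<close>

definition c0 :: "(nat \<Rightarrow>\<^sub>C complex) set" where
  "c0 = {x. apply_bcontfun x \<longlonglongrightarrow> 0}"

definition clinear_on ::
    "'a::complex_normed_vector set \<Rightarrow> ('a \<Rightarrow> 'b::complex_normed_vector) \<Rightarrow> bool" where
  "clinear_on S f \<longleftrightarrow>
    (\<forall>x\<in>S. \<forall>y\<in>S. f (x + y) = f x + f y) \<and> (\<forall>c. \<forall>x\<in>S. f (c *\<^sub>C x) = c *\<^sub>C f x)"

definition contains_copy_of_c0 :: "'a::complex_normed_vector itself \<Rightarrow> bool" where
  "contains_copy_of_c0 _ \<longleftrightarrow>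
    (\<exists>(F :: 'a set) f g. complex_vector.subspace F \<and> closed F \<and>
      clinear_on c0 f \<and> homeomorphism c0 F f g)"

section \<open>Operators\<close>

text \<open>\<^typ>\<open>'a \<Rightarrow>\<^sub>L 'a\<close> consists of the bounded real-linear operators; this is its subset of
  complex-linear ones. The operator norm is the same in both cases.\<close>

definition bounded_coperators :: "('a::complex_normed_vector \<Rightarrow>\<^sub>L 'a) set" where
  "bounded_coperators = {T. \<forall>c x. blinfun_apply T (c *\<^sub>C x) = c *\<^sub>C blinfun_apply T x}"

definition blinfun_pow :: "('a::real_normed_vector \<Rightarrow>\<^sub>L 'a) \<Rightarrow> nat \<Rightarrow> ('a \<Rightarrow>\<^sub>L 'a)" where
  "blinfun_pow T n = (((o\<^sub>L) T) ^^ n) id_blinfun"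

definition power_bounded :: "('a::real_normed_vector \<Rightarrow>\<^sub>L 'a) \<Rightarrow> bool" where
  "power_bounded T \<longleftrightarrow> bdd_above (range (\<lambda>n. norm (blinfun_pow T n)))"

definition power_bounded_below :: "('a::real_normed_vector \<Rightarrow>\<^sub>L 'a) \<Rightarrow> bool" where
  "power_bounded_below T \<longleftrightarrow>
    (\<forall>x. x \<noteq> 0 \<longrightarrow> (INF n. norm (blinfun_apply (blinfun_pow T n) x)) > 0)"

definition doubly_power_bounded :: "('a::complex_normed_vector \<Rightarrow>\<^sub>L 'a) \<Rightarrow> bool" where
  "doubly_power_bounded T \<longleftrightarrow>
    (\<exists>S\<in>bounded_coperators. T o\<^sub>L S = id_blinfun \<and> S o\<^sub>L T = id_blinfun \<and>
      power_bounded T \<and> power_bounded S)"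

definition relatively_compact_orbits_on ::
    "('a::real_normed_vector \<Rightarrow>\<^sub>L 'a) \<Rightarrow> 'a set \<Rightarrow> bool" where
  "relatively_compact_orbits_on T F \<longleftrightarrow>
    (\<forall>y\<in>F. compact (closure (range (\<lambda>n. blinfun_apply (blinfun_pow T n) y))))"

definition mean_ergodic :: "('a::complex_normed_vector \<Rightarrow>\<^sub>L 'a) \<Rightarrow> bool" where
  "mean_ergodic T \<longleftrightarrow>
    (\<exists>P\<in>bounded_coperators.
      P \<in> strong_operator_topology closure_of (convex hull (range (blinfun_pow T))) \<and>
      P o\<^sub>L P = P \<and> P o\<^sub>L T = P \<and> T o\<^sub>L P = P)"

end

theory Submission
  imports Defs "HOL-Library.Diagonal_Subsequence"
begin

text \<open>
  Write \<open>c m = T\<^sup>m x - x\<close>. These vectors lie in the range of \<open>I - T\<close>, they are uniformly bounded,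
  and \<open>c (m + q) = c m + T\<^sup>m (c q)\<close>. Suppose that the orbits on the range of \<open>I - T\<close> are relatively
  compact, that \<open>T\<close> is power-bounded and power-bounded below, and that the orbit of \<open>x\<close> is not
  relatively compact. Vectors with relatively compact orbits are then recurrent
  (\<open>recurrent_return_times\<close>): a nonzero vector has no power tending to zero, so nothing can be lost
  along the orbit. The return times can be taken among the differences of a sequence of times at
  which the orbit of \<open>x\<close> is separated, so that \<open>c\<close> is bounded away from zero on them. Choosing return
  times \<open>p\<^sub>0, p\<^sub>1, \<dots>\<close> such that each \<open>T\<^bsup>p\<^sub>k\<^esup>\<close> almost fixes everything built from the earlier ones, the
  cocycle identity turns every finite sum of the vectors \<open>c (p\<^sub>k)\<close> into a single value of \<open>c\<close>, up to a
  bounded error. Hence all finite sums are bounded while the terms are bounded away from zero, and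
  the criterion of Bessaga and Pelczynski (\<open>bessaga_pelczynski\<close>) produces a copy of \<open>c\<^sub>0\<close>. It follows
  from the Hahn--Banach theorem and Rosenthal's disjointification lemma.

  For a power-bounded operator with relatively compact orbits on the range of \<open>I - T\<close>, mean
  ergodicity and relative compactness of all orbits are the same. If all orbits are relatively
  compact, Mazur's theorem gives cluster points of the Cesaro means, and these cluster points are
  limits. Conversely, \<open>x = P x + (x - P x)\<close> splits \<open>x\<close> into a fixed vector and a vector in the closure
  of the range of \<open>I - T\<close>, and relative compactness of orbits survives limits and sums.

  Suppose finally that \<open>E\<close> is separable and \<open>f\<close> embeds \<open>c\<^sub>0\<close> in \<open>E\<close>. By Sobczyk's theorem (\<open>sobczyk\<close>, with
  Veech's proof) \<open>f\<close> has a bounded left inverse \<open>Q\<close>, so operators on \<open>c\<^sub>0\<close> extend to \<open>E\<close>. The space of convergent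
  sequences, which is isomorphic to \<open>c\<^sub>0\<close>, carries the rotation that multiplies the \<open>k\<close>-th entry by
  \<open>exp (i/k)\<close>; it does not change limits, and a fixed sequence vanishes, so the constant sequence has
  no ergodic projection. Moved to \<open>c\<^sub>0\<close> and extended to \<open>E\<close> this is a doubly power-bounded operator that
  is not mean ergodic although its orbits on the range of \<open>I - T\<close> are relatively compact
  (\<open>separable_copy_of_c0_counterexample\<close>).
\<close>

section \<open>Extension of real functionals\<close>

text \<open>
  Partial functionals are handled through their graphs, which are the real subspaces of pairs
  \<open>(x, r)\<close> with \<open>r \<le> p x\<close>: such a subspace is automatically single-valued, because \<open>(0, r)\<close> and
  \<open>(0, - r)\<close> both belong to it as soon as one of them does. Zorn's lemma then needs no gluing of
  functions, and a maximal graph is total.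
\<close>
theorem hahn_banach_sublinear:
  fixes p :: "'a::real_vector \<Rightarrow> real" and u :: "'a \<Rightarrow> real"
  assumes sub: "\<And>x y. p (x + y) \<le> p x + p y"
    and pos: "\<And>t x. 0 < t \<Longrightarrow> p (t *\<^sub>R x) = t * p x"
    and S: "subspace S"
    and add: "\<And>x y. x \<in> S \<Longrightarrow> y \<in> S \<Longrightarrow> u (x + y) = u x + u y"
    and scale: "\<And>t x. x \<in> S \<Longrightarrow> u (t *\<^sub>R x) = t * u x"
    and le: "\<And>x. x \<in> S \<Longrightarrow> u x \<le> p x"
  obtains v where "linear v" "\<And>x. x \<in> S \<Longrightarrow> v x = u x" "\<And>x. v x \<le> p x"
proof -
  define G0 where "G0 = (\<lambda>x. (x, u x)) ` S"
  define \<A> where "\<A> = {G. subspace G \<and> G0 \<subseteq> G \<and> (\<forall>(x, r)\<in>G. r \<le> p x)}"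
  have "u 0 = 0"
    using scale[of 0 0] subspace_0[OF S] by simp
  then have "subspace G0"
    unfolding G0_def subspace_def
    using subspace_0[OF S] subspace_add[OF S] subspace_scale[OF S]
    by (auto simp: image_iff zero_prod_def add scale)
  then have "G0 \<in> \<A>"
    using le by (auto simp: \<A>_def G0_def)
  have union: "\<Union>\<C> \<in> \<A>" if ne: "\<C> \<noteq> {}" and chain: "subset.chain \<A> \<C>" for \<C>
  proof -
    have sp: "subspace G" if "G \<in> \<C>" for G
      using chain that by (auto simp: subset.chain_def \<A>_def)
    have "subspace (\<Union>\<C>)"
      unfolding subspace_def
    proof (intro conjI ballI allI)
      show "0 \<in> \<Union>\<C>"
        using ne sp subspace_0 by blast
    next
      fix a b assume "a \<in> \<Union>\<C>" "b \<in> \<Union>\<C>"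
      then obtain A B where AB: "A \<in> \<C>" "B \<in> \<C>" "a \<in> A" "b \<in> B"
        by blast
      then have "A \<subseteq> B \<or> B \<subseteq> A"
        using chain by (auto simp: subset.chain_def)
      then show "a + b \<in> \<Union>\<C>"
        using AB sp by (meson UnionI subsetD subspace_add)
    next
      fix t a assume "a \<in> \<Union>\<C>"
      then show "t *\<^sub>R a \<in> \<Union>\<C>"
        using sp subspace_scale by blast
    qed
    moreover have "G0 \<subseteq> \<Union>\<C>" "\<forall>(x, r)\<in>\<Union>\<C>. r \<le> p x"
      using ne chain by (fastforce simp: subset.chain_def \<A>_def)+
    ultimately show ?thesis
      by (simp add: \<A>_def)
  qed
  obtain G where "G \<in> \<A>" and max: "\<And>H. H \<in> \<A> \<Longrightarrow> G \<subseteq> H \<Longrightarrow> H = G"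
    using subset_Zorn_nonempty[of \<A>] union \<open>G0 \<in> \<A>\<close> by blast
  then have G: "subspace G" "G0 \<subseteq> G" "\<And>x r. (x, r) \<in> G \<Longrightarrow> r \<le> p x"
    by (auto simp: \<A>_def)
  have p0: "p 0 = 0"
    using pos[of 2 0] by simp
  have uniq: "r = s" if "(x, r) \<in> G" "(x, s) \<in> G" for x r s
  proof -
    have "(0, r - s) \<in> G" "(0, s - r) \<in> G"
      using subspace_diff[OF G(1) that] subspace_diff[OF G(1) that(2,1)] by simp_all
    then show ?thesis
      using G(3)[of 0 "r - s"] G(3)[of 0 "s - r"] p0 by simp
  qed
  have total: "\<exists>r. (x0, r) \<in> G" for x0
  proof -
    \<comment> \<open>The admissible values at \<open>x0\<close> form an interval, which is nonempty by subadditivity.\<close>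
    have key: "r - p (x - x0) \<le> p (y + x0) - s" if "(x, r) \<in> G" "(y, s) \<in> G" for x r y s
    proof -
      have "r + s \<le> p (x + y)"
        using G(3)[of "x + y" "r + s"] subspace_add[OF G(1) that] by simp
      also have "\<dots> \<le> p (x - x0) + p (y + x0)"
        using sub[of "x - x0" "y + x0"] by simp
      finally show ?thesis
        by simp
    qed
    define L where "L = (\<lambda>(x, r). r - p (x - x0)) ` G"
    define s where "s = Sup L"
    have zero: "(0, 0) \<in> G"
      using subspace_0[OF G(1)] by (simp add: zero_prod_def)
    then have "L \<noteq> {}"
      by (auto simp: L_def)
    have bdd: "bdd_above L"
      unfolding L_def using key[OF _ zero] by (intro bdd_aboveI[of _ "p (0 + x0) - 0"]) auto
    have lower: "r - p (x - x0) \<le> s" if "(x, r) \<in> G" for x r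
      unfolding s_def using that by (intro cSup_upper bdd) (force simp: L_def)
    have upper: "s \<le> p (x + x0) - r" if "(x, r) \<in> G" for x r
      unfolding s_def using key[OF _ that] \<open>L \<noteq> {}\<close>
      by (intro cSup_least) (auto simp: L_def)
    define H where "H = span (insert (x0, s) G)"
    have "r \<le> p x" if xr: "(x, r) \<in> H" for x r
    proof -
      obtain t where t: "(x, r) - t *\<^sub>R (x0, s) \<in> span G"
        using xr unfolding H_def span_insert by blast
      then have mem: "(x - t *\<^sub>R x0, r - t * s) \<in> G"
        using G(1) by (simp add: span_eq_iff[symmetric] del: span_eq_iff)
      consider "t = 0" | "t > 0" | "t < 0"
        by linarith
      then show ?thesis
      proof cases
        case 1
        then show ?thesis
          using mem G(3) by simp
      next
        case 2
        have "((1/t) *\<^sub>R (x - t *\<^sub>R x0), (1/t) * (r - t * s)) \<in> G"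
          using subspace_scale[OF G(1) mem, of "1/t"] by simp
        from upper[OF this] have "s \<le> p ((1/t) *\<^sub>R x) - (1/t) * (r - t * s)"
          using 2 by (simp add: algebra_simps)
        also have "p ((1/t) *\<^sub>R x) = (1/t) * p x"
          using 2 by (intro pos) simp
        finally show ?thesis
          using 2 by (simp add: field_simps)
      next
        case 3
        have "((-1/t) *\<^sub>R (x - t *\<^sub>R x0), (-1/t) * (r - t * s)) \<in> G"
          using subspace_scale[OF G(1) mem, of "-1/t"] by simp
        from lower[OF this] have "(-1/t) * (r - t * s) - p ((-1/t) *\<^sub>R x) \<le> s"
          using 3 by (simp add: algebra_simps)
        moreover have "p ((-1/t) *\<^sub>R x) = (-1/t) * p x"
          using 3 by (intro pos) (simp add: field_simps)
        ultimately show ?thesis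
          using 3 by (simp add: field_simps)
      qed
    qed
    moreover have "insert (x0, s) G \<subseteq> H"
      unfolding H_def by (rule span_superset)
    ultimately have "H \<in> \<A>"
      using G(2) by (auto simp: \<A>_def H_def)
    with max[of H] \<open>insert (x0, s) G \<subseteq> H\<close> have "H = G"
      by blast
    then show ?thesis
      using \<open>insert (x0, s) G \<subseteq> H\<close> by blast
  qed
  obtain v where v: "\<And>x. (x, v x) \<in> G"
    using total by metis
  show thesis
  proof
    show "linear v"
    proof
      fix x y and t :: real
      show "v (x + y) = v x + v y"
        using uniq[OF v[of "x + y"]] subspace_add[OF G(1) v[of x] v[of y]] by simp
      show "v (t *\<^sub>R x) = t *\<^sub>R v x"
        using uniq[OF v[of "t *\<^sub>R x"]] subspace_scale[OF G(1) v[of x], of t] by simp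
    qed
    show "v x = u x" if "x \<in> S" for x
      using uniq[OF v[of x]] G(2) that by (auto simp: G0_def)
    show "v x \<le> p x" for x
      using G(3) v by blast
  qed
qed

text \<open>
  Real functionals suffice also for complex spaces: the modulus of a complex coefficient is
  recovered later by rotating the whole vector.
\<close>
corollary norming_functional:
  fixes x :: "'a::real_normed_vector"
  obtains v :: "'a \<Rightarrow> real" where "linear v" "v x = norm x" "\<And>y. \<bar>v y\<bar> \<le> norm y"
proof (cases "x = 0")
  case True
  have "linear (\<lambda>y :: 'a. 0 :: real)"
    by (simp add: linear_iff)
  with True show thesis
    using that[of "\<lambda>y. 0"] by simp
next
  case False
  define u where "u = (\<lambda>y. (SOME t. y = t *\<^sub>R x) * norm x)"
  have u: "u (t *\<^sub>R x) = t * norm x" for t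
    using False by (simp add: u_def)
  obtain v where v: "linear v" "\<And>y. y \<in> span {x} \<Longrightarrow> v y = u y" "\<And>y. v y \<le> norm y"
  proof (rule hahn_banach_sublinear[of norm "span {x}" u])
    show "norm (t *\<^sub>R y) = t * norm y" if "0 < t" for t and y :: 'a
      using that by simp
    show "subspace (span {x})"
      by (rule subspace_span)
    show "u y \<le> norm y" if "y \<in> span {x}" for y
      using that by (auto simp: span_singleton u intro!: mult_right_mono)
    show "u (t *\<^sub>R y) = t * u y" if "y \<in> span {x}" for t y
      using that u[of "t * _"] by (auto simp: span_singleton u)
    show "u (y + z) = u y + u z" if yz: "y \<in> span {x}" "z \<in> span {x}" for y z
    proof -
      obtain s t where "y = s *\<^sub>R x" "z = t *\<^sub>R x"
        using yz by (auto simp: span_singleton)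
      then show ?thesis
        using u[of "s + t"] by (simp add: u scaleR_add_left distrib_right)
    qed
  qed (use norm_triangle_ineq in blast)+
  have "\<bar>v y\<bar> \<le> norm y" for y
    using v(3)[of y] v(3)[of "- y"] linear_neg[OF v(1), of y] by simp
  moreover have "v x = norm x"
    using v(2)[of x] u[of 1] by (simp add: span_base)
  ultimately show thesis
    using v(1) that by blast
qed

section \<open>Rosenthal's disjointification lemma\<close>

text \<open>
  The rows are split along infinitely many disjoint infinite index sets. If none of the pieces is
  good, each contains a row whose sum over its own piece exceeds \<open>\<epsilon>\<close>. Restricted to the indices of
  these rows, every row has lost this amount, so its remaining sum is smaller by \<open>\<epsilon>\<close>. After finitely
  many rounds nothing is left to lose.
\<close>
lemma rosenthal_disjointification:
  fixes a :: "nat \<Rightarrow> nat \<Rightarrow> real"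
  assumes nonneg: "\<And>k j. 0 \<le> a k j"
    and bound: "\<And>k F. finite F \<Longrightarrow> sum (a k) F \<le> C"
    and "0 < \<epsilon>"
  obtains N where "infinite N" "\<And>k F. k \<in> N \<Longrightarrow> finite F \<Longrightarrow> F \<subseteq> N - {k} \<Longrightarrow> sum (a k) F \<le> \<epsilon>"
proof -
  define good where
    "good = (\<lambda>b N. \<forall>k\<in>N. \<forall>F. finite F \<and> F \<subseteq> N - {k} \<longrightarrow> sum (a k) F \<le> b)"
  have step: "\<exists>N. infinite N \<and> good \<epsilon> N" if "infinite A" "good (real m * \<epsilon>) A" for m A
    using that
  proof (induction m arbitrary: A)
    case 0
    have "good \<epsilon> A"
      unfolding good_def
    proof (intro ballI allI impI)
      fix k F assume "k \<in> A" "finite F \<and> F \<subseteq> A - {k}"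
      then have "sum (a k) F \<le> real 0 * \<epsilon>"
        using 0(2) unfolding good_def by blast
      then show "sum (a k) F \<le> \<epsilon>"
        using \<open>0 < \<epsilon>\<close> by simp
    qed
    then show ?case
      using 0 by blast
  next
    case (Suc m)
    define B where "B = (\<lambda>i. range (\<lambda>j. enumerate A (prod_encode (i, j))))"
    have inj: "inj (enumerate A)"
      using Suc.prems(1) by (simp add: strict_mono_enumerate strict_mono_imp_inj_on)
    have BA: "B i \<subseteq> A" for i
      using Suc.prems(1) by (auto simp: B_def enumerate_in_set)
    have inf: "infinite (B i)" for i
      unfolding B_def
      by (rule range_inj_infinite) (auto intro!: injI dest!: injD[OF inj])
    have disj: "B i \<inter> B j = {}" if "i \<noteq> j" for i j
      using that by (auto simp: B_def dest!: injD[OF inj])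
    show ?case
    proof (cases "\<exists>i. good \<epsilon> (B i)")
      case True
      then show ?thesis
        using inf by blast
    next
      case False
      have "\<exists>k F. k \<in> B i \<and> finite F \<and> F \<subseteq> B i - {k} \<and> \<epsilon> < sum (a k) F" for i
      proof -
        have "\<not> good \<epsilon> (B i)"
          using False by blast
        then obtain k F where "k \<in> B i" "finite F" "F \<subseteq> B i - {k}" "\<not> sum (a k) F \<le> \<epsilon>"
          unfolding good_def by blast
        then show ?thesis
          using not_le by blast
      qed
      then obtain k F where kF: "\<And>i. k i \<in> B i" "\<And>i. finite (F i)"
          "\<And>i. F i \<subseteq> B i - {k i}" "\<And>i. \<epsilon> < sum (a (k i)) (F i)"
        by metis
      have "inj k"
        by (rule injI) (metis IntI disj empty_iff kF(1))
      then have "infinite (range k)"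
        by (rule range_inj_infinite)
      moreover have "good (real m * \<epsilon>) (range k)"
        unfolding good_def
      proof (intro ballI allI impI)
        fix l G assume "l \<in> range k" and G: "finite G \<and> G \<subseteq> range k - {l}"
        then obtain i where i: "l = k i"
          by blast
        have "G \<inter> F i = {}"
        proof (rule ccontr)
          assume "G \<inter> F i \<noteq> {}"
          then obtain j where "k j \<in> F i" "k j \<noteq> k i"
            using G i by blast
          then show False
            using kF(1)[of j] kF(3)[of i] disj[of i j] by auto
        qed
        then have "sum (a l) G + sum (a l) (F i) = sum (a l) (G \<union> F i)"
          using G kF(2)[of i] by (simp add: sum.union_disjoint)
        also have "\<dots> \<le> real (Suc m) * \<epsilon>"
        proof -
          have "G \<union> F i \<subseteq> A - {l}"
            using G kF(1,3) BA i by blast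
          moreover have "l \<in> A"
            using i kF(1) BA by blast
          ultimately show ?thesis
            using Suc.prems(2) G kF(2)[of i] by (auto simp: good_def)
        qed
        finally show "sum (a l) G \<le> real m * \<epsilon>"
          using kF(4)[of i] i by (simp add: algebra_simps)
      qed
      ultimately show ?thesis
        by (rule Suc.IH)
    qed
  qed
  obtain m where "C \<le> real m * \<epsilon>"
    using reals_Archimedean3[OF \<open>0 < \<epsilon>\<close>] by (meson less_imp_le)
  then have "good (real m * \<epsilon>) UNIV"
    using bound by (auto simp: good_def intro: order_trans)
  from step[OF _ this] obtain N where "infinite N" "good \<epsilon> N"
    by auto
  then show thesis
    by (intro that[of N]) (auto simp: good_def)
qed

section \<open>The space of null sequences\<close>

lemma scaleC_Re_Im: "a *\<^sub>C x = Re a *\<^sub>R x + Im a *\<^sub>R \<i> *\<^sub>C x"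
proof -
  have "a *\<^sub>C x = (complex_of_real (Re a) + complex_of_real (Im a) * \<i>) *\<^sub>C x"
    by (metis complex_eq mult.commute)
  also have "\<dots> = Re a *\<^sub>R x + Im a *\<^sub>R \<i> *\<^sub>C x"
    by (simp only: scaleC_add_left scaleR_scaleC scaleC_scaleC)
  finally show ?thesis .
qed

lemma closed_c0: "closed c0"
  unfolding closed_sequential_limits
proof (intro allI impI, elim conjE)
  fix X l assume X: "\<forall>n. X n \<in> c0" and "X \<longlonglongrightarrow> l"
  show "l \<in> c0"
    unfolding c0_def mem_Collect_eq tendsto_iff
  proof (intro allI impI)
    fix e :: real assume "0 < e"
    then have "\<forall>\<^sub>F n in sequentially. dist (X n) l < e/2"
      using \<open>X \<longlonglongrightarrow> l\<close> by (intro tendstoD) auto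
    then obtain n where n: "dist (X n) l < e/2"
      by (auto simp: eventually_sequentially)
    have "\<forall>\<^sub>F k in sequentially. dist (X n k) 0 < e/2"
      using X \<open>0 < e\<close> unfolding c0_def mem_Collect_eq by (intro tendstoD) auto
    then show "\<forall>\<^sub>F k in sequentially. dist (l k) 0 < e"
    proof eventually_elim
      case (elim k)
      have "dist (X n k) (l k) < e/2"
        using dist_bounded[of "X n" k l] n by simp
      then show ?case
        using elim dist_triangle2[of "l k" 0 "X n k"]
          dist_triangle_half_r[of "X n k" "l k" e 0] by simp
    qed
  qed
qed

lemma Cauchy_bcontfun_convergent:
  fixes X :: "nat \<Rightarrow> 'a::topological_space \<Rightarrow>\<^sub>C 'b::complete_space"
  assumes "Cauchy X"
  obtains l where "X \<longlonglongrightarrow> l"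
proof -
  from assms obtain g where "uniform_limit UNIV X g sequentially"
    using uniformly_convergent_eq_cauchy[of "\<lambda>_. True" X]
    unfolding Cauchy_def uniform_limit_sequentially_iff
    by (metis dist_fun_lt_imp_dist_val_lt)
  from uniform_limit_bcontfunE[OF this sequentially_bot] show thesis
    using that by blast
qed

lemma subspace_c0: "complex_vector.subspace c0"
  unfolding complex_vector.subspace_def
proof (intro conjI ballI allI)
  show "0 \<in> c0"
    by (simp add: c0_def)
next
  fix x y assume "x \<in> c0" "y \<in> c0"
  then show "x + y \<in> c0"
    using tendsto_add_zero[of x sequentially y] by (simp add: c0_def)
next
  fix c x assume "x \<in> c0"
  then show "c *\<^sub>C x \<in> c0"
    using tendsto_mult_right_zero[of x sequentially c]
    by (simp add: c0_def apply_bcontfun_scaleC[abs_def] scaleC_complex_def)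
qed

lemmas zero_in_c0 = complex_vector.subspace_0[OF subspace_c0]
  and c0_add = complex_vector.subspace_add[OF subspace_c0]
  and c0_scaleC = complex_vector.subspace_scale[OF subspace_c0]

lemma clinear_on_c0D:
  assumes "clinear_on c0 f"
  shows "x \<in> c0 \<Longrightarrow> y \<in> c0 \<Longrightarrow> f (x + y) = f x + f y"
    and "x \<in> c0 \<Longrightarrow> f (c *\<^sub>C x) = c *\<^sub>C f x"
    and "f 0 = 0"
proof -
  show "x \<in> c0 \<Longrightarrow> y \<in> c0 \<Longrightarrow> f (x + y) = f x + f y"
    and scale: "x \<in> c0 \<Longrightarrow> f (c *\<^sub>C x) = c *\<^sub>C f x" for x y c
    using assms by (simp_all add: clinear_on_def)
  show "f 0 = 0"
    using scale[OF zero_in_c0, of 0] by simp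
qed

text \<open>
  The two-sided estimate makes \<open>f\<close> a homeomorphism onto its image, and the image is closed because
  Cauchy sequences in it come from Cauchy sequences in the complete space \<open>c0\<close>.
\<close>
lemma contains_copy_of_c0I:
  fixes f :: "(nat \<Rightarrow>\<^sub>C complex) \<Rightarrow> 'a::complex_banach"
  assumes lin: "clinear_on c0 f"
    and upper: "\<And>a. a \<in> c0 \<Longrightarrow> norm (f a) \<le> C * norm a"
    and lower: "\<And>a. a \<in> c0 \<Longrightarrow> c * norm a \<le> norm (f a)"
    and "0 < c"
  shows "contains_copy_of_c0 TYPE('a)"
proof -
  have diff: "f (a - b) = f a - f b" "a - b \<in> c0" if "a \<in> c0" "b \<in> c0" for a b
  proof -
    show "a - b \<in> c0"
      using subspace_c0 that by (rule complex_vector.subspace_diff)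
    then have "f (a - b + b) = f (a - b) + f b"
      using lin that \<open>a - b \<in> c0\<close> unfolding clinear_on_def by blast
    then show "f (a - b) = f a - f b"
      by simp
  qed
  have up: "dist (f a) (f b) \<le> C * dist a b" and low: "c * dist a b \<le> dist (f a) (f b)"
    if "a \<in> c0" "b \<in> c0" for a b
    using upper[OF diff(2)[OF that]] lower[OF diff(2)[OF that]] diff(1)[OF that]
    by (simp_all add: dist_norm)
  have inj: "inj_on f c0"
  proof (rule inj_onI)
    fix a b assume "a \<in> c0" "b \<in> c0" "f a = f b"
    then have "c * dist a b \<le> 0"
      using low[of a b] by simp
    then show "a = b"
      using \<open>0 < c\<close> by (simp add: mult_le_0_iff)
  qed
  have cont: "continuous_on c0 f"
  proof (rule lipschitz_on_continuous_on)
    show "\<bar>C\<bar>-lipschitz_on c0 f"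
    proof (rule lipschitz_onI)
      fix a b assume "a \<in> c0" "b \<in> c0"
      then have "dist (f a) (f b) \<le> C * dist a b"
        by (rule up)
      also have "\<dots> \<le> \<bar>C\<bar> * dist a b"
        by (intro mult_right_mono) auto
      finally show "dist (f a) (f b) \<le> \<bar>C\<bar> * dist a b" .
    qed simp
  qed
  define g where "g = inv_into c0 f"
  have gf: "g (f a) = a" if "a \<in> c0" for a
    using inj that by (simp add: g_def)
  have cont_inv: "continuous_on (f ` c0) g"
  proof (rule lipschitz_on_continuous_on)
    show "(1/c)-lipschitz_on (f ` c0) g"
    proof (rule lipschitz_onI)
      fix y z assume "y \<in> f ` c0" "z \<in> f ` c0"
      then obtain a b where "a \<in> c0" "b \<in> c0" "y = f a" "z = f b"
        by blast
      then show "dist (g y) (g z) \<le> 1/c * dist y z"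
        using low[of a b] \<open>0 < c\<close> by (simp add: gf field_simps)
    qed (use \<open>0 < c\<close> in simp)
  qed
  have "closed (f ` c0)"
    unfolding closed_sequential_limits
  proof (intro allI impI, elim conjE)
    fix Y l assume "\<forall>n. Y n \<in> f ` c0" and Y: "Y \<longlonglongrightarrow> l"
    then have "\<forall>n. \<exists>a\<in>c0. Y n = f a"
      by blast
    then obtain X where X: "\<And>n. X n \<in> c0" "\<And>n. Y n = f (X n)"
      by metis
    have "Cauchy X"
    proof (rule metric_CauchyI)
      fix e :: real assume "0 < e"
      then have "0 < c * e"
        using \<open>0 < c\<close> by simp
      from metric_CauchyD[OF LIMSEQ_imp_Cauchy[OF Y] this]
      obtain n0 where n0: "\<forall>m\<ge>n0. \<forall>n\<ge>n0. dist (Y m) (Y n) < c * e"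
        by blast
      have "dist (X m) (X n) < e" if "m \<ge> n0" "n \<ge> n0" for m n
      proof -
        have "c * dist (X m) (X n) < c * e"
          using n0 that low[OF X(1)[of m] X(1)[of n]] X(2) by fastforce
        then show ?thesis
          using \<open>0 < c\<close> by simp
      qed
      then show "\<exists>n0. \<forall>m\<ge>n0. \<forall>n\<ge>n0. dist (X m) (X n) < e"
        by blast
    qed
    then obtain a where a: "X \<longlonglongrightarrow> a"
      by (rule Cauchy_bcontfun_convergent)
    then have "a \<in> c0"
      by (rule closed_sequentially[OF closed_c0 X(1)])
    then have "(\<lambda>n. f (X n)) \<longlonglongrightarrow> f a"
      using continuous_on_tendsto_compose[OF cont a] X(1) by simp
    then have "l = f a"
      using LIMSEQ_unique[OF Y, of "f a"] by (simp flip: X(2))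
    then show "l \<in> f ` c0"
      using \<open>a \<in> c0\<close> by blast
  qed
  moreover have "complex_vector.subspace (f ` c0)"
    unfolding complex_vector.subspace_def
  proof (intro conjI ballI allI)
    show "0 \<in> f ` c0"
      using clinear_on_c0D(3)[OF lin] zero_in_c0 by (metis image_eqI)
  next
    fix y z assume "y \<in> f ` c0" "z \<in> f ` c0"
    then obtain a b where "a \<in> c0" "b \<in> c0" "y = f a" "z = f b"
      by blast
    moreover from this have "f (a + b) = y + z"
      by (simp add: clinear_on_c0D(1)[OF lin])
    ultimately show "y + z \<in> f ` c0"
      using c0_add by (metis image_eqI)
  next
    fix s y assume "y \<in> f ` c0"
    then obtain a where "a \<in> c0" "y = f a"
      by blast
    moreover from this have "f (s *\<^sub>C a) = s *\<^sub>C y"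
      by (simp add: clinear_on_c0D(2)[OF lin])
    ultimately show "s *\<^sub>C y \<in> f ` c0"
      using c0_scaleC by (metis image_eqI)
  qed
  moreover have "homeomorphism c0 (f ` c0) f g"
    using cont cont_inv by (auto simp: homeomorphism_def gf image_image)
  ultimately show ?thesis
    using lin unfolding contains_copy_of_c0_def by blast
qed

section \<open>Series with bounded finite sums\<close>

lemma linear_scaleC_comp:
  fixes v :: "'a::complex_normed_vector \<Rightarrow> real"
  assumes "linear v"
  shows "linear (\<lambda>y. v (c *\<^sub>C y))"
  using linear_compose[OF bounded_linear.linear[OF bounded_linear_scaleC_right] assms]
  by (simp add: o_def)

text \<open>
  Splitting the index set by the sign of the terms turns absolute values into values of \<open>v\<close> at two
  finite sums. This is where boundedness of all finite sums enters, rather than of partial sums only.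
\<close>
lemma sum_abs_functional_le:
  fixes v :: "'a::real_normed_vector \<Rightarrow> real"
  assumes v: "linear v" "\<And>y. \<bar>v y\<bar> \<le> norm y"
    and x: "\<And>F. finite F \<Longrightarrow> norm (sum x F) \<le> C" and "finite F"
  shows "(\<Sum>j\<in>F. \<bar>v (x j)\<bar>) \<le> 2 * C"
proof -
  define P where "P = {j \<in> F. 0 \<le> v (x j)}"
  have fin: "finite P" "finite (F - P)"
    using \<open>finite F\<close> by (auto simp: P_def)
  have "(\<Sum>j\<in>F. \<bar>v (x j)\<bar>) = (\<Sum>j\<in>F - P. \<bar>v (x j)\<bar>) + (\<Sum>j\<in>P. \<bar>v (x j)\<bar>)"
    using \<open>finite F\<close> by (intro sum.subset_diff) (auto simp: P_def)
  also have "(\<Sum>j\<in>P. \<bar>v (x j)\<bar>) = v (sum x P)"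
    by (simp add: linear_sum[OF v(1)] P_def)
  also have "(\<Sum>j\<in>F - P. \<bar>v (x j)\<bar>) = (\<Sum>j\<in>F - P. - v (x j))"
    by (intro sum.cong) (auto simp: P_def)
  also have "\<dots> = - v (sum x (F - P))"
    by (simp add: linear_sum[OF v(1)] sum_negf)
  finally show ?thesis
    using v(2)[of "sum x P"] v(2)[of "sum x (F - P)"] x[OF fin(1)] x[OF fin(2)] by linarith
qed

text \<open>
  The vectors \<open>\<i> x\<^sub>j\<close> are included because a real functional sees the complex multiples of \<open>x\<^sub>j\<close> through
  its values at \<open>x\<^sub>j\<close> and at \<open>\<i> x\<^sub>j\<close>.
\<close>
lemma sum_abs_complex_functional_le:
  fixes x :: "'i \<Rightarrow> 'a::complex_normed_vector"
  assumes v: "linear v" "\<And>y. \<bar>v y\<bar> \<le> norm y"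
    and x: "\<And>F. finite F \<Longrightarrow> norm (sum x F) \<le> C" and "finite F"
  shows "(\<Sum>j\<in>F. \<bar>v (x j)\<bar> + \<bar>v (\<i> *\<^sub>C x j)\<bar>) \<le> 4 * C"
proof -
  have "\<bar>v (\<i> *\<^sub>C y)\<bar> \<le> norm y" for y
    using v(2)[of "\<i> *\<^sub>C y"] by (simp add: norm_scaleC)
  from sum_abs_functional_le[OF linear_scaleC_comp[OF v(1)] this x \<open>finite F\<close>]
  show ?thesis
    using sum_abs_functional_le[OF v x \<open>finite F\<close>] by (simp add: sum.distrib)
qed

lemma abs_functional_scaleC_le:
  fixes x :: "'a::complex_normed_vector"
  assumes "linear v"
  shows "\<bar>v (a *\<^sub>C x)\<bar> \<le> cmod a * (\<bar>v x\<bar> + \<bar>v (\<i> *\<^sub>C x)\<bar>)"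
proof -
  have "v (a *\<^sub>C x) = Re a * v x + Im a * v (\<i> *\<^sub>C x)"
    by (simp add: scaleC_Re_Im[of a x] linear_add[OF assms] linear_scale[OF assms])
  also have "\<bar>\<dots>\<bar> \<le> \<bar>Re a\<bar> * \<bar>v x\<bar> + \<bar>Im a\<bar> * \<bar>v (\<i> *\<^sub>C x)\<bar>"
    by (metis abs_mult abs_triangle_ineq)
  also have "\<dots> \<le> cmod a * \<bar>v x\<bar> + cmod a * \<bar>v (\<i> *\<^sub>C x)\<bar>"
    by (intro add_mono mult_right_mono abs_Re_le_cmod abs_Im_le_cmod) auto
  finally show ?thesis
    by (simp add: distrib_left)
qed

lemma norm_sum_scaleC_le:
  fixes x :: "'i \<Rightarrow> 'a::complex_normed_vector"
  assumes x: "\<And>F. finite F \<Longrightarrow> norm (sum x F) \<le> C" and "finite F"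
    and a: "\<And>j. j \<in> F \<Longrightarrow> cmod (a j) \<le> s" and "0 \<le> s"
  shows "norm (\<Sum>j\<in>F. a j *\<^sub>C x j) \<le> 4 * C * s"
proof -
  obtain v :: "'a \<Rightarrow> real" where v: "linear v" "\<And>y. \<bar>v y\<bar> \<le> norm y"
    and eq: "v (\<Sum>j\<in>F. a j *\<^sub>C x j) = norm (\<Sum>j\<in>F. a j *\<^sub>C x j)"
    using norming_functional by metis
  have "norm (\<Sum>j\<in>F. a j *\<^sub>C x j) = (\<Sum>j\<in>F. v (a j *\<^sub>C x j))"
    unfolding eq[symmetric] by (rule linear_sum[OF v(1)])
  also have "\<dots> \<le> (\<Sum>j\<in>F. s * (\<bar>v (x j)\<bar> + \<bar>v (\<i> *\<^sub>C x j)\<bar>))"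
  proof (rule sum_mono)
    fix j assume "j \<in> F"
    have "v (a j *\<^sub>C x j) \<le> cmod (a j) * (\<bar>v (x j)\<bar> + \<bar>v (\<i> *\<^sub>C x j)\<bar>)"
      using abs_functional_scaleC_le[OF v(1)] abs_le_D1 by blast
    also have "\<dots> \<le> s * (\<bar>v (x j)\<bar> + \<bar>v (\<i> *\<^sub>C x j)\<bar>)"
      using a[OF \<open>j \<in> F\<close>] by (intro mult_right_mono) auto
    finally show "v (a j *\<^sub>C x j) \<le> s * (\<bar>v (x j)\<bar> + \<bar>v (\<i> *\<^sub>C x j)\<bar>)" .
  qed
  also have "\<dots> = s * (\<Sum>j\<in>F. \<bar>v (x j)\<bar> + \<bar>v (\<i> *\<^sub>C x j)\<bar>)"
    by (simp add: sum_distrib_left)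
  also have "\<dots> \<le> s * (4 * C)"
    using sum_abs_complex_functional_le[OF v x \<open>finite F\<close>] \<open>0 \<le> s\<close>
    by (intro mult_left_mono) auto
  finally show ?thesis
    by (simp add: mult_ac)
qed

text \<open>
  Functionals \<open>v\<^sub>k\<close> norming \<open>x\<^sub>k\<close> give a matrix with bounded rows. On an index set where the off-diagonal
  row sums are at most \<open>\<delta>/2\<close>, the functional \<open>v\<^sub>k\<close> recovers the \<open>k\<close>-th coefficient from the sum of the
  series up to half of its size, so the coefficients are controlled by the norm of the sum. The
  reverse estimate is \<open>norm_sum_scaleC_le\<close>.
\<close>
theorem bessaga_pelczynski:
  fixes x :: "nat \<Rightarrow> 'a::complex_banach"
  assumes x: "\<And>F. finite F \<Longrightarrow> norm (sum x F) \<le> C"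
    and \<delta>: "0 < \<delta>" "\<And>n. \<delta> \<le> norm (x n)"
  shows "contains_copy_of_c0 TYPE('a)"
proof -
  have "\<forall>n. \<exists>v :: 'a \<Rightarrow> real. linear v \<and> v (x n) = norm (x n) \<and> (\<forall>y. \<bar>v y\<bar> \<le> norm y)"
    using norming_functional by metis
  then obtain v :: "nat \<Rightarrow> 'a \<Rightarrow> real" where v: "\<And>n. linear (v n)" "\<And>n. v n (x n) = norm (x n)"
      "\<And>n y. \<bar>v n y\<bar> \<le> norm y"
    by metis
  define b where "b = (\<lambda>k j. \<bar>v k (x j)\<bar> + \<bar>v k (\<i> *\<^sub>C x j)\<bar>)"
  obtain N where N: "infinite N"
      "\<And>k F. k \<in> N \<Longrightarrow> finite F \<Longrightarrow> F \<subseteq> N - {k} \<Longrightarrow> sum (b k) F \<le> \<delta>/2"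
  proof (rule rosenthal_disjointification[of b "4 * C" "\<delta>/2"])
    show "sum (b k) F \<le> 4 * C" if "finite F" for k F
      unfolding b_def by (rule sum_abs_complex_functional_le[OF v(1,3) x that])
  qed (use \<open>0 < \<delta>\<close> in \<open>auto simp: b_def\<close>)
  define r where "r = enumerate N"
  have r: "inj r" "\<And>n. r n \<in> N"
    using N(1) by (simp_all add: r_def strict_mono_enumerate strict_mono_imp_inj_on enumerate_in_set)
  define z where "z = (\<lambda>n. x (r n))"
  have z: "norm (sum z F) \<le> C" if "finite F" for F
    using x[of "r ` F"] that sum.reindex[of r F x] inj_on_subset[OF r(1)]
    by (simp add: z_def o_def)
  have lower_finite: "cmod (a k) * \<delta> \<le> norm (\<Sum>j\<in>F. a j *\<^sub>C z j) + s * (\<delta>/2)"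
    if F: "finite F" "k \<in> F" and a: "\<And>j. cmod (a j) \<le> s" for F k a s
  proof -
    \<comment> \<open>Rotating by \<open>c\<close> makes the \<open>k\<close>-th coefficient real, so that \<open>v (r k)\<close> attains its modulus.\<close>
    obtain c where c: "c * a k = complex_of_real (cmod (a k))" "cmod c = 1"
    proof (cases "a k = 0")
      case True
      then show thesis
        using that[of 1] by simp
    next
      case False
      then show thesis
        using that[of "cnj (a k) / cmod (a k)"]
        by (simp add: norm_divide complex_norm_square[symmetric] power2_eq_square field_simps)
    qed
    define w where "w = v (r k)"
    have w: "linear w" "w (z k) = norm (z k)" "\<And>y. \<bar>w y\<bar> \<le> norm y"
      using v by (simp_all add: w_def z_def)
    have "c *\<^sub>C (\<Sum>j\<in>F. a j *\<^sub>C z j) = (\<Sum>j\<in>F. (c * a j) *\<^sub>C z j)"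
      by (simp add: complex_vector.scale_sum_right)
    also have "\<dots> = cmod (a k) *\<^sub>R z k + (\<Sum>j\<in>F - {k}. (c * a j) *\<^sub>C z j)"
      using F by (simp add: sum.remove c(1) scaleR_scaleC)
    finally have "w (c *\<^sub>C (\<Sum>j\<in>F. a j *\<^sub>C z j)) =
        cmod (a k) * norm (z k) + (\<Sum>j\<in>F - {k}. w ((c * a j) *\<^sub>C z j))"
      by (simp add: linear_add[OF w(1)] linear_scale[OF w(1)] linear_sum[OF w(1)] w(2))
    moreover have "w (c *\<^sub>C (\<Sum>j\<in>F. a j *\<^sub>C z j)) \<le> norm (\<Sum>j\<in>F. a j *\<^sub>C z j)"
      using w(3)[of "c *\<^sub>C (\<Sum>j\<in>F. a j *\<^sub>C z j)"] c(2) by (simp add: norm_scaleC)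
    moreover have "cmod (a k) * \<delta> \<le> cmod (a k) * norm (z k)"
      using \<delta>(2) by (intro mult_left_mono) (auto simp: z_def)
    moreover have "- (\<Sum>j\<in>F - {k}. w ((c * a j) *\<^sub>C z j)) \<le> s * (\<delta>/2)"
    proof -
      have "- (\<Sum>j\<in>F - {k}. w ((c * a j) *\<^sub>C z j)) = (\<Sum>j\<in>F - {k}. - w ((c * a j) *\<^sub>C z j))"
        by (simp add: sum_negf)
      also have "\<dots> \<le> (\<Sum>j\<in>F - {k}. s * b (r k) (r j))"
      proof (rule sum_mono)
        fix j
        have "- w ((c * a j) *\<^sub>C z j) \<le> cmod (c * a j) * b (r k) (r j)"
          using abs_functional_scaleC_le[OF w(1), of "c * a j" "z j"]
          by (simp add: b_def w_def z_def)
        also have "\<dots> \<le> s * b (r k) (r j)"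
          using a[of j] c(2) by (intro mult_right_mono) (auto simp: b_def norm_mult)
        finally show "- w ((c * a j) *\<^sub>C z j) \<le> s * b (r k) (r j)" .
      qed
      also have "\<dots> = s * sum (b (r k)) (r ` (F - {k}))"
        using inj_on_subset[OF r(1)] by (simp add: sum.reindex sum_distrib_left)
      also have "\<dots> \<le> s * (\<delta>/2)"
      proof (intro mult_left_mono N(2))
        show "r ` (F - {k}) \<subseteq> N - {r k}"
          using r by (auto dest: injD)
        show "0 \<le> s"
          using a[of k] norm_ge_zero order_trans by blast
      qed (use F r in auto)
      finally show ?thesis .
    qed
    ultimately show ?thesis
      by linarith
  qed
  have summable: "summable (\<lambda>j. a j *\<^sub>C z j)" if "a \<in> c0" for a :: "nat \<Rightarrow>\<^sub>C complex"
    unfolding summable_Cauchy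
  proof (intro allI impI)
    fix e :: real assume "0 < e"
    have "0 \<le> C"
      using x[of "{}"] by simp
    define \<eta> where "\<eta> = e / (4 * C + 1)"
    have "0 < \<eta>"
      using \<open>0 < e\<close> \<open>0 \<le> C\<close> by (simp add: \<eta>_def)
    have "a \<longlonglongrightarrow> 0"
      using that by (simp add: c0_def)
    then have "\<forall>\<^sub>F j in sequentially. dist (a j) 0 < \<eta>"
      using \<open>0 < \<eta>\<close> by (rule tendstoD)
    then obtain n0 where n0: "\<And>j. n0 \<le> j \<Longrightarrow> cmod (a j) < \<eta>"
      by (auto simp: eventually_sequentially)
    have "norm (\<Sum>j=m..<n. a j *\<^sub>C z j) < e" if "n0 \<le> m" for m n
    proof -
      have "norm (\<Sum>j=m..<n. a j *\<^sub>C z j) \<le> 4 * C * \<eta>"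
        using n0 that \<open>0 < \<eta>\<close> by (intro norm_sum_scaleC_le z) (auto intro: less_imp_le)
      also have "\<dots> < (4 * C + 1) * \<eta>"
        using \<open>0 < \<eta>\<close> by (simp add: distrib_right)
      also have "\<dots> = e"
        using \<open>0 \<le> C\<close> by (simp add: \<eta>_def)
      finally show ?thesis .
    qed
    then show "\<exists>N. \<forall>m\<ge>N. \<forall>n. norm (\<Sum>j=m..<n. a j *\<^sub>C z j) < e"
      by blast
  qed
  define f where "f = (\<lambda>a :: nat \<Rightarrow>\<^sub>C complex. \<Sum>j. a j *\<^sub>C z j)"
  have lim: "(\<lambda>n. norm (\<Sum>j<n. a j *\<^sub>C z j)) \<longlonglongrightarrow> norm (f a)" if "a \<in> c0" for a
    unfolding f_def by (intro tendsto_norm summable_LIMSEQ summable that)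
  show ?thesis
  proof (rule contains_copy_of_c0I)
    show "clinear_on c0 f"
      unfolding clinear_on_def f_def
      by (auto simp: scaleC_add_left apply_bcontfun_scaleC scaleC_complex_def
          complex_vector.scale_scale[symmetric] suminf_add summable
          bounded_linear.suminf[OF bounded_linear_scaleC_right] simp del: complex_vector.scale_scale)
    show "norm (f a) \<le> 4 * C * norm a" if "a \<in> c0" for a
      using norm_bounded[of a]
      by (intro tendsto_upperbound[OF lim[OF that]] always_eventually allI norm_sum_scaleC_le z) auto
    show "\<delta>/2 * norm a \<le> norm (f a)" if "a \<in> c0" for a
    proof -
      have le: "cmod (a k) * \<delta> \<le> norm (f a) + norm a * (\<delta>/2)" for k
      proof (rule tendsto_lowerbound)
        show "(\<lambda>n. norm (\<Sum>j<n. a j *\<^sub>C z j) + norm a * (\<delta>/2)) \<longlonglongrightarrow> norm (f a) + norm a * (\<delta>/2)"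
          by (intro tendsto_add lim that tendsto_const)
        show "\<forall>\<^sub>F n in sequentially.
            cmod (a k) * \<delta> \<le> norm (\<Sum>j<n. a j *\<^sub>C z j) + norm a * (\<delta>/2)"
          using eventually_gt_at_top[of k]
        proof eventually_elim
          case (elim n)
          then show ?case
            by (intro lower_finite norm_bounded) auto
        qed
      qed simp
      have "norm a \<le> (norm (f a) + norm a * (\<delta>/2)) / \<delta>"
        using le \<open>0 < \<delta>\<close> by (intro norm_bound) (simp add: field_simps)
      then show ?thesis
        using \<open>0 < \<delta>\<close> by (simp add: field_simps)
    qed
  qed (use \<open>0 < \<delta>\<close> in auto)
qed

section \<open>Powers and orbits of an operator\<close>

lemma blinfun_pow_0 [simp]: "blinfun_pow T 0 = id_blinfun"
  by (simp add: blinfun_pow_def)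

lemma blinfun_pow_apply: "blinfun_apply (blinfun_pow T n) x = (blinfun_apply T ^^ n) x"
  by (induction n) (simp_all add: blinfun_pow_def)

lemma blinfun_pow_Suc_apply:
  "blinfun_apply (blinfun_pow T (Suc n)) x = T (blinfun_pow T n x)"
  by (simp add: blinfun_pow_apply)

lemma blinfun_pow_Suc_apply2:
  "blinfun_apply (blinfun_pow T (Suc n)) x = blinfun_pow T n (T x)"
  by (simp add: blinfun_pow_apply funpow_swap1)

lemma blinfun_pow_add_apply:
  "blinfun_apply (blinfun_pow T (m + n)) x = blinfun_pow T m (blinfun_pow T n x)"
  by (simp add: blinfun_pow_apply funpow_add)

lemma blinfun_pow_commute:
  "blinfun_apply (blinfun_pow T m) (blinfun_pow T n x) = blinfun_pow T n (blinfun_pow T m x)"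
  by (metis add.commute blinfun_pow_add_apply)

text \<open>
  A bound at least 1 can be divided by, whatever the space is.
\<close>
lemma power_boundedE:
  assumes "power_bounded T"
  obtains M where "1 \<le> M" "\<And>n x. norm (blinfun_pow T n x) \<le> M * norm x"
proof -
  obtain B where B: "\<And>n. norm (blinfun_pow T n) \<le> B"
    using assms by (auto simp: power_bounded_def bdd_above_def)
  have "norm (blinfun_pow T n x) \<le> max 1 B * norm x" for n x
  proof -
    have "norm (blinfun_pow T n x) \<le> norm (blinfun_pow T n) * norm x"
      by (rule norm_blinfun)
    also have "\<dots> \<le> max 1 B * norm x"
      using B[of n] by (intro mult_right_mono) auto
    finally show ?thesis .
  qed
  then show thesis
    using that[of "max 1 B"] by simp
qed

lemma power_bounded_belowD:
  assumes "power_bounded_below T" and "(\<lambda>k. blinfun_pow T (n k) x) \<longlonglongrightarrow> 0"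
  shows "x = 0"
proof (rule ccontr)
  assume "x \<noteq> 0"
  define c where "c = (INF n. norm (blinfun_pow T n x))"
  have "0 < c"
    using assms(1) \<open>x \<noteq> 0\<close> by (simp add: power_bounded_below_def c_def)
  have "c \<le> norm (blinfun_pow T (n k) x)" for k
    unfolding c_def by (intro cINF_lower bdd_belowI[of _ 0]) auto
  then have "c \<le> 0"
    using LIMSEQ_le_const[OF tendsto_norm_zero[OF assms(2)]] by blast
  with \<open>0 < c\<close> show False
    by simp
qed

lemma compact_closure_iff_totally_bounded:
  fixes S :: "'a::complete_space set"
  shows "compact (closure S) \<longleftrightarrow> (\<forall>\<epsilon>>0. \<exists>K. finite K \<and> S \<subseteq> (\<Union>x\<in>K. ball x \<epsilon>))"
proof
  assume "compact (closure S)"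
  then show "\<forall>\<epsilon>>0. \<exists>K. finite K \<and> S \<subseteq> (\<Union>x\<in>K. ball x \<epsilon>)"
    using closure_subset[of S] unfolding compact_eq_totally_bounded by (meson subset_trans)
next
  assume tb: "\<forall>\<epsilon>>0. \<exists>K. finite K \<and> S \<subseteq> (\<Union>x\<in>K. ball x \<epsilon>)"
  show "compact (closure S)"
    unfolding compact_eq_totally_bounded
  proof (intro conjI allI impI)
    show "complete (closure S)"
      by (simp add: complete_eq_closed)
    fix \<epsilon> :: real assume "0 < \<epsilon>"
    then obtain K where K: "finite K" "S \<subseteq> (\<Union>x\<in>K. ball x (\<epsilon>/2))"
      using tb half_gt_zero by blast
    have "closure S \<subseteq> (\<Union>x\<in>K. cball x (\<epsilon>/2))"
    proof (intro closure_minimal closed_UN ballI K(1) closed_cball)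
      show "S \<subseteq> (\<Union>x\<in>K. cball x (\<epsilon>/2))"
        using K(2) ball_subset_cball by (meson UN_mono order_refl order_trans)
    qed
    also have "\<dots> \<subseteq> (\<Union>x\<in>K. ball x \<epsilon>)"
      using \<open>0 < \<epsilon>\<close> by fastforce
    finally show "\<exists>K. finite K \<and> closure S \<subseteq> (\<Union>x\<in>K. ball x \<epsilon>)"
      using K(1) by blast
  qed
qed

text \<open>
  A sequence that is not totally bounded leaves every finite union of \<open>\<delta>\<close>-balls, so the next time can
  be chosen far from all earlier terms of the sequence, not only from the selected ones. This makes
  the chosen times increase by themselves.
\<close>
lemma separated_subsequence:
  fixes u :: "nat \<Rightarrow> 'a::complete_space"
  assumes "\<not> compact (closure (range u))"
  obtains \<delta> and r :: "nat \<Rightarrow> nat" where "0 < \<delta>" "strict_mono r" "\<And>i j. i < j \<Longrightarrow> \<delta> \<le> dist (u (r i)) (u (r j))"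
proof -
  obtain \<delta> where \<delta>: "0 < \<delta>" "\<And>K. finite K \<Longrightarrow> \<not> range u \<subseteq> (\<Union>x\<in>K. ball x \<delta>)"
    using assms unfolding compact_closure_iff_totally_bounded by blast
  have "\<exists>m. \<forall>i\<le>n. \<delta> \<le> dist (u i) (u m)" for n
  proof -
    have "\<not> range u \<subseteq> (\<Union>x\<in>u ` {..n}. ball x \<delta>)"
      by (intro \<delta>(2)) simp
    then obtain m where "u m \<notin> (\<Union>x\<in>u ` {..n}. ball x \<delta>)"
      by blast
    then show ?thesis
      by (auto simp: not_less intro!: exI[of _ m])
  qed
  then obtain h where h: "\<And>n i. i \<le> n \<Longrightarrow> \<delta> \<le> dist (u i) (u (h n))"
    by metis
  define r where "r = (\<lambda>k. (h ^^ k) 0)"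
  have r_Suc: "r (Suc k) = h (r k)" for k
    by (simp add: r_def)
  have "n < h n" for n
  proof (rule ccontr)
    assume "\<not> n < h n"
    then show False
      using h[of "h n" n] \<open>0 < \<delta>\<close> by simp
  qed
  then have r: "strict_mono r"
    by (simp add: strict_mono_Suc_iff r_Suc)
  have "\<delta> \<le> dist (u (r i)) (u (r j))" if ij: "i < j" for i j
  proof -
    obtain k where "j = Suc k" "i \<le> k"
      using ij by (cases j) auto
    then show ?thesis
      using h[of "r i" "r k"] r by (simp add: r_Suc strict_mono_less_eq)
  qed
  with \<open>0 < \<delta>\<close> r show thesis
    using that by blast
qed

abbreviation relatively_compact_orbit :: "('a::real_normed_vector \<Rightarrow>\<^sub>L 'a) \<Rightarrow> 'a \<Rightarrow> bool" where
  "relatively_compact_orbit T x \<equiv> compact (closure (range (\<lambda>n. blinfun_apply (blinfun_pow T n) x)))"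

lemma convergent_orbit_subsequence:
  fixes n :: "nat \<Rightarrow> nat"
  assumes "finite Y"
    and "\<And>y. y \<in> Y \<Longrightarrow> relatively_compact_orbit T y"
  obtains r :: "nat \<Rightarrow> nat" and z where "strict_mono r"
    "\<And>y. y \<in> Y \<Longrightarrow> (\<lambda>k. blinfun_pow T (n (r k)) y) \<longlonglongrightarrow> z y"
proof -
  have "\<exists>r z. strict_mono (r :: nat \<Rightarrow> nat) \<and> (\<forall>y\<in>Y. (\<lambda>k. blinfun_pow T (n (r k)) y) \<longlonglongrightarrow> z y)"
    using assms
  proof (induction Y)
    case empty
    then show ?case
      using strict_mono_id by auto
  next
    case (insert y Y)
    then obtain r z where r: "strict_mono (r :: nat \<Rightarrow> nat)"
      and z: "\<And>y. y \<in> Y \<Longrightarrow> (\<lambda>k. blinfun_pow T (n (r k)) y) \<longlonglongrightarrow> z y"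
      by auto
    have "seq_compact (closure (range (\<lambda>n. blinfun_pow T n y)))"
      using insert.prems by (simp add: compact_eq_seq_compact_metric)
    moreover have "\<forall>k. blinfun_pow T (n (r k)) y \<in> closure (range (\<lambda>n. blinfun_pow T n y))"
      by (intro allI subsetD[OF closure_subset] rangeI)
    ultimately obtain l s where s: "strict_mono (s :: nat \<Rightarrow> nat)"
      and l: "((\<lambda>k. blinfun_pow T (n (r k)) y) \<circ> s) \<longlonglongrightarrow> l"
      by (rule seq_compactE)
    have "strict_mono (r \<circ> s)"
      using r s by (rule strict_mono_o)
    moreover have "(\<lambda>k. blinfun_pow T (n ((r \<circ> s) k)) y') \<longlonglongrightarrow> (z(y := l)) y'"
      if "y' \<in> insert y Y" for y'
    proof (cases "y' = y")
      case True
      then show ?thesis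
        using l by (simp add: o_def)
    next
      case False
      then show ?thesis
        using LIMSEQ_subseq_LIMSEQ[OF z[of y'] s] that by (simp add: o_def)
    qed
    ultimately show ?case
      by blast
  qed
  then show thesis
    using that by blast
qed

section \<open>Recurrence and copies of the space of null sequences\<close>

text \<open>
  Along a subsequence \<open>p\<^sub>k\<close> of the given times the orbit of \<open>y\<close> converges to some \<open>z\<close>, and with
  \<open>l\<^sub>k = p\<^bsub>k+1\<^esub> - p\<^sub>k\<close> both \<open>T\<^bsup>l\<^sub>k\<^esup> z \<longlonglongrightarrow> z\<close> and, after a further choice, \<open>T\<^bsup>l\<^sub>k\<^esup> y \<longlonglongrightarrow> w\<close>. Exchanging the
  two limits gives \<open>T\<^bsup>p\<^sub>j\<^esup> w \<longlonglongrightarrow> z\<close>, so \<open>T\<^bsup>p\<^sub>j\<^esup> (w - y) \<longlonglongrightarrow> 0\<close>, and \<open>w = y\<close> because \<open>T\<close> is power-bounded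
  below. The return times \<open>l\<^sub>k\<close> are differences of the given times, so a separation of another orbit
  along the given times carries over to them.
\<close>
lemma recurrent_return_times:
  fixes T :: "'a::real_normed_vector \<Rightarrow>\<^sub>L 'a" and n :: "nat \<Rightarrow> nat"
  assumes "power_bounded T" "power_bounded_below T" and n: "strict_mono n"
    and Y: "finite Y" "\<And>y. y \<in> Y \<Longrightarrow> relatively_compact_orbit T y"
    and "0 < \<epsilon>"
  obtains i j where "i < j" "\<And>y. y \<in> Y \<Longrightarrow> norm (blinfun_pow T (n j - n i) y - y) < \<epsilon>"
proof -
  obtain M where M: "1 \<le> M" "\<And>n x. norm (blinfun_pow T n x) \<le> M * norm x"
    using power_boundedE[OF assms(1)] by blast
  obtain r z where r: "strict_mono r"
    and z: "\<And>y. y \<in> Y \<Longrightarrow> (\<lambda>k. blinfun_pow T (n (r k)) y) \<longlonglongrightarrow> z y"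
    using convergent_orbit_subsequence[OF Y] by blast
  define p where "p = (\<lambda>k. n (r k))"
  define l where "l = (\<lambda>k. p (Suc k) - p k)"
  have p: "p (Suc k) = l k + p k" for k
    using strict_monoD[OF n strict_monoD[OF r, of k "Suc k"]] by (simp add: l_def p_def)
  obtain s w where s: "strict_mono s"
    and w: "\<And>y. y \<in> Y \<Longrightarrow> (\<lambda>k. blinfun_pow T (l (s k)) y) \<longlonglongrightarrow> w y"
    using convergent_orbit_subsequence[OF Y] by blast
  have wy: "w y = y" if "y \<in> Y" for y
  proof -
    have pz: "(\<lambda>k. blinfun_pow T (p k) y) \<longlonglongrightarrow> z y"
      using z[OF that] by (simp add: p_def)
    have "(\<lambda>k. blinfun_pow T (l k) (z y - blinfun_pow T (p k) y)) \<longlonglongrightarrow> 0"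
    proof (rule Lim_null_comparison)
      show "\<forall>\<^sub>F k in sequentially. norm (blinfun_pow T (l k) (z y - blinfun_pow T (p k) y))
          \<le> M * norm (z y - blinfun_pow T (p k) y)"
        using M(2) by simp
      show "(\<lambda>k. M * norm (z y - blinfun_pow T (p k) y)) \<longlonglongrightarrow> 0"
        using tendsto_mult_left[OF tendsto_norm[OF tendsto_diff[OF tendsto_const pz]], of M "z y"]
        by simp
    qed
    moreover have "(\<lambda>k. blinfun_pow T (p (Suc k)) y) \<longlonglongrightarrow> z y"
      using pz by (rule LIMSEQ_Suc)
    ultimately have "(\<lambda>k. blinfun_pow T (l k) (z y - blinfun_pow T (p k) y)
        + blinfun_pow T (p (Suc k)) y) \<longlonglongrightarrow> 0 + z y"
      by (rule tendsto_add)
    then have "(\<lambda>k. blinfun_pow T (l k) (z y)) \<longlonglongrightarrow> z y"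
      by (simp add: p blinfun_pow_add_apply blinfun.diff_right)
    from LIMSEQ_subseq_LIMSEQ[OF this s]
    have lz: "(\<lambda>k. blinfun_pow T (l (s k)) (z y)) \<longlonglongrightarrow> z y"
      by (simp add: o_def)
    have le: "norm (blinfun_pow T (p j) (w y) - z y) \<le> M * norm (blinfun_pow T (p j) y - z y)" for j
    proof (rule tendsto_upperbound)
      have "(\<lambda>k. blinfun_pow T (p j) (blinfun_pow T (l (s k)) y) - blinfun_pow T (l (s k)) (z y))
          \<longlonglongrightarrow> blinfun_pow T (p j) (w y) - z y"
        by (intro tendsto_diff blinfun.tendsto tendsto_const w[OF that] lz)
      then show "(\<lambda>k. norm (blinfun_pow T (l (s k)) (blinfun_pow T (p j) y - z y)))
          \<longlonglongrightarrow> norm (blinfun_pow T (p j) (w y) - z y)"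
        by (intro tendsto_norm) (simp add: blinfun.diff_right blinfun_pow_commute[of T _ "p j"])
      show "\<forall>\<^sub>F k in sequentially. norm (blinfun_pow T (l (s k)) (blinfun_pow T (p j) y - z y))
          \<le> M * norm (blinfun_pow T (p j) y - z y)"
        using M(2) by simp
    qed simp
    have "(\<lambda>j. blinfun_pow T (p j) (w y) - z y) \<longlonglongrightarrow> 0"
    proof (rule Lim_null_comparison)
      show "\<forall>\<^sub>F j in sequentially. norm (blinfun_pow T (p j) (w y) - z y)
          \<le> M * norm (blinfun_pow T (p j) y - z y)"
        using le by simp
      show "(\<lambda>j. M * norm (blinfun_pow T (p j) y - z y)) \<longlonglongrightarrow> 0"
        using tendsto_mult_left[OF tendsto_norm[OF tendsto_diff[OF pz tendsto_const]], of M "z y"]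
        by simp
    qed
    from tendsto_diff[OF this tendsto_diff[OF pz tendsto_const[of "z y"]]]
    have "(\<lambda>j. blinfun_pow T (p j) (w y - y)) \<longlonglongrightarrow> 0"
      by (simp add: blinfun.diff_right)
    from power_bounded_belowD[OF assms(2) this] show ?thesis
      by simp
  qed
  have "\<forall>\<^sub>F k in sequentially. \<forall>y\<in>Y. dist (blinfun_pow T (l (s k)) y) y < \<epsilon>"
  proof (intro eventually_ball_finite Y(1) ballI)
    fix y assume "y \<in> Y"
    then show "\<forall>\<^sub>F k in sequentially. dist (blinfun_pow T (l (s k)) y) y < \<epsilon>"
      using w[of y] wy[of y] \<open>0 < \<epsilon>\<close> by (intro tendstoD) auto
  qed
  then obtain k where k: "\<And>y. y \<in> Y \<Longrightarrow> dist (blinfun_pow T (l (s k)) y) y < \<epsilon>"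
    by (auto simp: eventually_sequentially)
  show thesis
  proof (rule that[of "r (s k)" "r (Suc (s k))"])
    show "r (s k) < r (Suc (s k))"
      using r by (simp add: strict_monoD)
    show "norm (blinfun_pow T (n (r (Suc (s k))) - n (r (s k))) y - y) < \<epsilon>" if "y \<in> Y" for y
      using k[OF that] by (simp add: l_def p_def dist_norm)
  qed
qed

lemma blinfun_pow_diff_in_range:
  "blinfun_pow T n x - x \<in> range (blinfun_apply (id_blinfun - T))"
proof -
  have "blinfun_pow T n x - x = (id_blinfun - T) (- (\<Sum>k<n. blinfun_pow T k x))"
  proof (induction n)
    case (Suc n)
    then show ?case
      by (simp add: blinfun.diff_left blinfun.bilinear_simps blinfun_pow_Suc_apply algebra_simps)
  qed (simp add: blinfun.zero_right)
  then show ?thesis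
    by blast
qed

text \<open>
  The sequence to which the criterion applies is \<open>T\<^bsup>p\<^sub>k\<^esup> x - x\<close>, with return times \<open>p\<^sub>k\<close> of increasing
  precision for all of the finitely many vectors \<open>T\<^sup>q x - x\<close> that earlier sums of return times can produce.
\<close>
theorem contains_copy_of_c0_if_orbit_not_relatively_compact:
  fixes T :: "'a::complex_banach \<Rightarrow>\<^sub>L 'a"
  assumes T: "power_bounded T" "power_bounded_below T"
    and rg: "relatively_compact_orbits_on T (range (blinfun_apply (id_blinfun - T)))"
    and "\<not> relatively_compact_orbit T x"
  shows "contains_copy_of_c0 TYPE('a)"
proof -
  obtain M where M: "1 \<le> M" "\<And>n x. norm (blinfun_pow T n x) \<le> M * norm x"
    using power_boundedE[OF T(1)] by blast
  obtain \<delta> and n :: "nat \<Rightarrow> nat" where "0 < \<delta>" and n: "strict_mono n"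
    and sep: "\<And>i j. i < j \<Longrightarrow> \<delta> \<le> dist (blinfun_pow T (n i) x) (blinfun_pow T (n j) x)"
    using separated_subsequence[OF assms(4)] by blast
  define c where "c = (\<lambda>m. blinfun_pow T m x - x)"
  have c_add: "c (m + q) = c m + blinfun_pow T m (c q)" for m q
    by (simp add: c_def blinfun_pow_add_apply blinfun.diff_right)
  have c_bound: "norm (c m) \<le> (M + 1) * norm x" for m
    using norm_triangle_ineq4[of "blinfun_pow T m x" x] M(2)[of m x]
    by (simp add: c_def distrib_right)
  define return_time where "return_time = (\<lambda>(k :: nat) (Q :: nat) (p :: nat).
    \<delta>/M \<le> norm (c p) \<and> (\<forall>q\<le>Q. norm (blinfun_pow T p (c q) - c q) < (1/2)^k))"
  have "\<exists>p. return_time k Q p" for k Q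
  proof -
    have "relatively_compact_orbit T y" if "y \<in> c ` {..Q}" for y
      using that rg blinfun_pow_diff_in_range unfolding c_def relatively_compact_orbits_on_def by blast
    then obtain i j where "i < j"
      and ij: "\<And>y. y \<in> c ` {..Q} \<Longrightarrow> norm (blinfun_pow T (n j - n i) y - y) < (1/2)^k"
      using recurrent_return_times[OF T n, of "c ` {..Q}" "(1/2)^k"] by auto
    define p where "p = n j - n i"
    have "n j = n i + p"
      using strict_monoD[OF n \<open>i < j\<close>] by (simp add: p_def)
    then have "\<delta> \<le> norm (blinfun_pow T (n i) (c p))"
      using sep[OF \<open>i < j\<close>]
      by (simp add: c_def dist_norm norm_minus_commute blinfun_pow_add_apply blinfun.diff_right)
    also have "\<dots> \<le> M * norm (c p)"
      by (rule M(2))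
    finally have "\<delta>/M \<le> norm (c p)"
      using M(1) by (simp add: field_simps)
    then show ?thesis
      using ij by (auto simp: p_def return_time_def)
  qed
  then obtain h where "\<And>k Q. return_time k Q (h k Q)"
    by metis
  then have h: "\<delta>/M \<le> norm (c (h k Q))"
      "q \<le> Q \<Longrightarrow> norm (blinfun_pow T (h k Q) (c q) - c q) < (1/2)^k" for k Q q
    by (simp_all add: return_time_def)
  \<comment> \<open>Every sum of distinct \<open>p j\<close> with \<open>j < k\<close> is at most \<open>s k\<close>, so \<open>p k\<close> is a return time for all of them.\<close>
  define s where "s = rec_nat 0 (\<lambda>k s. s + h k s)"
  define p where "p = (\<lambda>k. h k (s k))"
  have s: "s k = (\<Sum>j<k. p j)" for k
    by (induction k) (simp_all add: s_def p_def)
  have approx: "norm (c (sum p F) - (\<Sum>j\<in>F. c (p j))) \<le> (\<Sum>j<k. (1/2)^j)" if "F \<subseteq> {..<k}" for F k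
    using that
  proof (induction k arbitrary: F)
    case 0
    then show ?case
      by (simp add: c_def)
  next
    case (Suc k)
    define G where "G = F - {k}"
    have G: "G \<subseteq> {..<k}" "finite G" "k \<notin> G"
      using Suc.prems by (auto simp: G_def less_Suc_eq intro: finite_subset[of _ "{..<Suc k}"])
    show ?case
    proof (cases "k \<in> F")
      case False
      then show ?thesis
        using Suc.IH[OF G(1)] by (simp add: G_def add_increasing2)
    next
      case True
      then have F: "F = insert k G"
        by (auto simp: G_def)
      have "sum p G \<le> s k"
        unfolding s using G by (intro sum_mono2) auto
      then have "norm (blinfun_pow T (p k) (c (sum p G)) - c (sum p G)) \<le> (1/2)^k"
        using h(2)[of "sum p G" "s k" k] by (simp add: p_def)
      moreover have "c (sum p F) - (\<Sum>j\<in>F. c (p j)) =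
          (c (sum p G) - (\<Sum>j\<in>G. c (p j))) + (blinfun_pow T (p k) (c (sum p G)) - c (sum p G))"
        using G by (simp add: F c_add)
      ultimately show ?thesis
        using Suc.IH[OF G(1)] norm_triangle_mono by fastforce
    qed
  qed
  have geometric: "(\<Sum>j<k. (1/2 :: real)^j) \<le> 2" for k
    by (simp add: sum_gp_strict)
  show ?thesis
  proof (rule bessaga_pelczynski[of "\<lambda>k. c (p k)"])
    fix F :: "nat set" assume "finite F"
    then obtain k where "F \<subseteq> {..<k}"
      using finite_nat_bounded by blast
    have "norm (\<Sum>j\<in>F. c (p j)) \<le> norm (c (sum p F)) + norm (c (sum p F) - (\<Sum>j\<in>F. c (p j)))"
      by (metis norm_minus_commute norm_triangle_sub)
    then show "norm (\<Sum>j\<in>F. c (p j)) \<le> (M + 1) * norm x + 2"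
      using approx[OF \<open>F \<subseteq> {..<k}\<close>] geometric[of k] c_bound[of "sum p F"] by linarith
  next
    show "0 < \<delta>/M"
      using \<open>0 < \<delta>\<close> M(1) by simp
    show "\<delta>/M \<le> norm (c (p k))" for k
      using h(1) by (simp add: p_def)
  qed
qed

section \<open>Mean ergodicity\<close>

lemma relatively_compact_orbit_closure:
  fixes T :: "'a::banach \<Rightarrow>\<^sub>L 'a"
  assumes "power_bounded T" and F: "\<And>y. y \<in> F \<Longrightarrow> relatively_compact_orbit T y"
    and x: "x \<in> closure F"
  shows "relatively_compact_orbit T x"
  unfolding compact_closure_iff_totally_bounded
proof (intro allI impI)
  fix \<epsilon> :: real assume "0 < \<epsilon>"
  obtain M where M: "1 \<le> M" "\<And>n x. norm (blinfun_pow T n x) \<le> M * norm x"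
    using power_boundedE[OF assms(1)] by blast
  have "0 < \<epsilon> / (2 * M)"
    using \<open>0 < \<epsilon>\<close> M(1) by simp
  then obtain y where y: "y \<in> F" "dist y x < \<epsilon> / (2 * M)"
    using x unfolding closure_approachable by blast
  obtain K where K: "finite K" "range (\<lambda>n. blinfun_pow T n y) \<subseteq> (\<Union>z\<in>K. ball z (\<epsilon>/2))"
    using F[OF y(1)] \<open>0 < \<epsilon>\<close> half_gt_zero unfolding compact_closure_iff_totally_bounded by blast
  have "blinfun_pow T n x \<in> (\<Union>z\<in>K. ball z \<epsilon>)" for n
  proof -
    have "blinfun_pow T n y \<in> (\<Union>z\<in>K. ball z (\<epsilon>/2))"
      using K(2) by blast
    then obtain z where z: "z \<in> K" "dist z (blinfun_pow T n y) < \<epsilon>/2"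
      by (auto simp del: less_divide_eq_numeral1)
    have "dist (blinfun_pow T n y) (blinfun_pow T n x) \<le> M * dist y x"
      using M(2)[of n "y - x"] by (simp add: dist_norm blinfun.diff_right)
    also have "\<dots> < \<epsilon>/2"
      using y(2) M(1) by (simp add: field_simps)
    finally have "dist z (blinfun_pow T n x) < \<epsilon>"
      using z(2) dist_triangle_half_r[of "blinfun_pow T n y" z \<epsilon> "blinfun_pow T n x"]
      by (simp add: dist_commute)
    then show ?thesis
      using z(1) by auto
  qed
  then show "\<exists>K. finite K \<and> range (\<lambda>n. blinfun_pow T n x) \<subseteq> (\<Union>z\<in>K. ball z \<epsilon>)"
    using K(1) by blast
qed

lemma relatively_compact_orbit_add:
  assumes "relatively_compact_orbit T x" "relatively_compact_orbit T y"
  shows "relatively_compact_orbit T (x + y)"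
proof -
  let ?S = "\<lambda>x. closure (range (\<lambda>n. blinfun_pow T n x))"
  have "compact {a + b |a b. a \<in> ?S x \<and> b \<in> ?S y}" (is "compact ?C")
    using compact_sums[OF assms] by simp
  moreover have "range (\<lambda>n. blinfun_pow T n (x + y)) \<subseteq> ?C"
  proof safe
    fix n
    have "blinfun_pow T n x \<in> ?S x" "blinfun_pow T n y \<in> ?S y"
      by (auto intro: subsetD[OF closure_subset])
    then show "\<exists>a b. blinfun_pow T n (x + y) = a + b \<and> a \<in> ?S x \<and> b \<in> ?S y"
      by (metis blinfun.add_right)
  qed
  ultimately have "?S (x + y) \<subseteq> ?C"
    by (intro closure_minimal compact_imp_closed)
  with \<open>compact ?C\<close> show ?thesis
    using compact_Int_closed[of ?C "?S (x + y)"] by (simp add: inf_absorb2)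
qed

lemma blinfun_pow_fixed:
  fixes T :: "'a::real_normed_vector \<Rightarrow>\<^sub>L 'a"
  assumes "T x = x"
  shows "blinfun_pow T n x = x"
  by (induction n) (simp_all add: blinfun_pow_Suc_apply assms)

lemma relatively_compact_orbit_fixed:
  fixes T :: "'a::real_normed_vector \<Rightarrow>\<^sub>L 'a"
  assumes "T x = x"
  shows "relatively_compact_orbit T x"
  using blinfun_pow_fixed[OF assms] by simp

lemma subspace_range_blinfun: "subspace (range (blinfun_apply T))"
  by (intro subspace_UNIV linear_subspace_image bounded_linear.linear blinfun.bounded_linear_right)

text \<open>
  The condition is convex in \<open>S\<close>, and \<open>x - T\<^sup>n x\<close> telescopes.
\<close>
lemma diff_convex_hull_pow_in_range:
  assumes "S \<in> convex hull (range (blinfun_pow T))"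
  shows "x - S x \<in> range (blinfun_apply (id_blinfun - T))"
proof -
  let ?R = "range (blinfun_apply (id_blinfun - T))"
  have sub: "subspace ?R"
    by (rule subspace_range_blinfun)
  have "convex {S. x - blinfun_apply S x \<in> ?R}"
    unfolding convex_def
  proof (intro ballI allI impI)
    fix S S' and u v :: real
    assume "S \<in> {S. x - blinfun_apply S x \<in> ?R}" "S' \<in> {S. x - blinfun_apply S x \<in> ?R}"
      and uv: "u + v = 1"
    then have *: "x - S x \<in> ?R" "x - S' x \<in> ?R"
      by simp_all
    have "x - blinfun_apply (u *\<^sub>R S + v *\<^sub>R S') x = (u + v) *\<^sub>R x - (u *\<^sub>R S x + v *\<^sub>R S' x)"
      by (simp add: uv blinfun.add_left blinfun.scaleR_left)
    also have "\<dots> = u *\<^sub>R (x - S x) + v *\<^sub>R (x - S' x)"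
      by (simp add: algebra_simps)
    also have "\<dots> \<in> ?R"
      using * by (intro subspace_add[OF sub] subspace_scale[OF sub])
    finally show "u *\<^sub>R S + v *\<^sub>R S' \<in> {S. x - blinfun_apply S x \<in> ?R}"
      by simp
  qed
  moreover have "range (blinfun_pow T) \<subseteq> {S. x - blinfun_apply S x \<in> ?R}"
  proof clarify
    fix n
    have "- (blinfun_pow T n x - x) \<in> ?R"
      using subspace_neg[OF sub] blinfun_pow_diff_in_range by blast
    then show "x - blinfun_pow T n x \<in> ?R"
      by simp
  qed
  ultimately show ?thesis
    using assms hull_minimal[of _ _ convex] by blast
qed

lemma strong_operator_closure_apply:
  assumes "P \<in> strong_operator_topology closure_of A"
  shows "blinfun_apply P x \<in> closure ((\<lambda>S. blinfun_apply S x) ` A)"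
  using continuous_map_image_closure_subset[OF strong_operator_topology_continuous_evaluation, of x A]
    assms by auto

lemma strong_operator_closureI:
  assumes A: "\<And>n :: nat. S n \<in> A" and lim: "\<And>x. (\<lambda>n. blinfun_apply (S n) x) \<longlonglongrightarrow> blinfun_apply P x"
  shows "P \<in> strong_operator_topology closure_of A"
  unfolding in_closure_of
proof (intro conjI allI impI)
  show "P \<in> topspace strong_operator_topology"
    by (simp add: strong_operator_topology_topspace)
  fix U assume "P \<in> U \<and> openin strong_operator_topology U"
  then obtain V where V: "open V" "U = blinfun_apply -` V"
    unfolding strong_operator_topology_def openin_pullback_topology by auto
  have "limitin (product_topology (\<lambda>_. euclidean) UNIV) (\<lambda>n. blinfun_apply (S n)) (blinfun_apply P) sequentially"
    using lim by (simp add: limitin_componentwise limitin_canonical_iff)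
  then have "(\<lambda>n. blinfun_apply (S n)) \<longlonglongrightarrow> blinfun_apply P"
    by (simp add: euclidean_product_topology limitin_canonical_iff)
  then have "\<forall>\<^sub>F n in sequentially. blinfun_apply (S n) \<in> V"
    using V \<open>P \<in> U \<and> _\<close> by (intro topological_tendstoD) auto
  then show "\<exists>y. y \<in> A \<and> y \<in> U"
    using A V(2) by (auto simp: eventually_sequentially)
qed

lemma diff_strong_closure_hull_pow_in_closure_range:
  assumes P: "P \<in> strong_operator_topology closure_of (convex hull (range (blinfun_pow T)))"
  shows "x - P x \<in> closure (range (blinfun_apply (id_blinfun - T)))" (is "_ \<in> closure ?R")
  unfolding closure_approachable
proof (intro allI impI)
  fix \<epsilon> :: real assume "0 < \<epsilon>"
  then obtain S where S: "S \<in> convex hull (range (blinfun_pow T))" "dist (S x) (P x) < \<epsilon>"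
    using strong_operator_closure_apply[OF P, of x] unfolding closure_approachable by blast
  then have "dist (x - S x) (x - P x) < \<epsilon>"
    by (simp add: dist_norm norm_minus_commute)
  then show "\<exists>y\<in>?R. dist y (x - P x) < \<epsilon>"
    using diff_convex_hull_pow_in_range[OF S(1)] by blast
qed

text \<open>
  \<open>P x\<close> is fixed because \<open>T P = P\<close>, and \<open>x - P x\<close> is a limit of vectors in the range of \<open>I - T\<close> because \<open>P\<close>
  is a strong limit of convex combinations of powers. Both have relatively compact orbits.
\<close>
theorem relatively_compact_orbits_if_mean_ergodic:
  fixes T :: "'a::complex_banach \<Rightarrow>\<^sub>L 'a"
  assumes "power_bounded T" "mean_ergodic T"
    and rg: "relatively_compact_orbits_on T (range (blinfun_apply (id_blinfun - T)))"
  shows "relatively_compact_orbits_on T UNIV"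
proof -
  let ?R = "range (blinfun_apply (id_blinfun - T))"
  obtain P where P: "P \<in> strong_operator_topology closure_of (convex hull (range (blinfun_pow T)))"
    and TP: "T o\<^sub>L P = P"
    using assms(2) by (auto simp: mean_ergodic_def)
  have "relatively_compact_orbit T x" for x
  proof -
    have "T (P x) = P x"
      using TP by (metis blinfun_apply_blinfun_compose)
    then have fixed: "relatively_compact_orbit T (P x)"
      by (rule relatively_compact_orbit_fixed)
    have "x - P x \<in> closure ?R"
      by (rule diff_strong_closure_hull_pow_in_closure_range[OF P])
    with rg have "relatively_compact_orbit T (x - P x)"
      unfolding relatively_compact_orbits_on_def
      using relatively_compact_orbit_closure[OF assms(1), of ?R "x - P x"] by blast
    from relatively_compact_orbit_add[OF this fixed] show ?thesis
      by simp
  qed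
  then show ?thesis
    by (simp add: relatively_compact_orbits_on_def)
qed

text \<open>
  Mazur's theorem: the convex hull of a totally bounded set lies near the convex hull of a finite
  set, and the latter is compact.
\<close>
lemma compact_closure_convex_hull:
  fixes S :: "'a::banach set"
  assumes "compact (closure S)"
  shows "compact (closure (convex hull S))"
  unfolding compact_closure_iff_totally_bounded
proof (intro allI impI)
  fix \<epsilon> :: real assume "0 < \<epsilon>"
  then obtain K where K: "finite K" "S \<subseteq> (\<Union>x\<in>K. ball x (\<epsilon>/2))"
    using assms half_gt_zero unfolding compact_closure_iff_totally_bounded by blast
  define H where "H = convex hull K"
  have "compact H"
    unfolding H_def by (rule finite_imp_compact_convex_hull[OF K(1)])
  then obtain L where L: "finite L" "H \<subseteq> (\<Union>x\<in>L. ball x (\<epsilon>/2))"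
    using \<open>0 < \<epsilon>\<close> half_gt_zero unfolding compact_eq_totally_bounded by blast
  have "convex (\<Union>x\<in>H. \<Union>y\<in>ball 0 (\<epsilon>/2). {x + y})"
    unfolding H_def by (intro convex_sums convex_convex_hull convex_ball)
  moreover have "S \<subseteq> (\<Union>x\<in>H. \<Union>y\<in>ball 0 (\<epsilon>/2). {x + y})"
  proof
    fix s assume "s \<in> S"
    then obtain k where k: "k \<in> K" "dist k s < \<epsilon>/2"
      using K(2) by auto
    then have "k \<in> H" "s - k \<in> ball 0 (\<epsilon>/2)" "s = k + (s - k)"
      by (auto simp: H_def hull_inc dist_norm norm_minus_commute)
    then show "s \<in> (\<Union>x\<in>H. \<Union>y\<in>ball 0 (\<epsilon>/2). {x + y})"
      by blast
  qed
  ultimately have hull: "convex hull S \<subseteq> (\<Union>x\<in>H. \<Union>y\<in>ball 0 (\<epsilon>/2). {x + y})"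
    by (intro hull_minimal)
  have "convex hull S \<subseteq> (\<Union>x\<in>L. ball x \<epsilon>)"
  proof
    fix s assume "s \<in> convex hull S"
    then obtain x y where xy: "x \<in> H" "norm y < \<epsilon>/2" "s = x + y"
      using hull by auto
    then obtain l where l: "l \<in> L" "dist l x < \<epsilon>/2"
      using L(2) by auto
    have "dist l s < \<epsilon>"
      using dist_triangle[of l s x] l(2) xy by (simp add: dist_norm)
    then show "s \<in> (\<Union>x\<in>L. ball x \<epsilon>)"
      using l(1) by auto
  qed
  then show "\<exists>K. finite K \<and> convex hull S \<subseteq> (\<Union>x\<in>K. ball x \<epsilon>)"
    using L(1) by blast
qed

definition cesaro_mean :: "('a::real_normed_vector \<Rightarrow>\<^sub>L 'a) \<Rightarrow> nat \<Rightarrow> 'a \<Rightarrow>\<^sub>L 'a" where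
  "cesaro_mean T n = (\<Sum>k\<le>n. (1 / real (Suc n)) *\<^sub>R blinfun_pow T k)"

lemma cesaro_mean_apply:
  "blinfun_apply (cesaro_mean T n) x = (1 / real (Suc n)) *\<^sub>R (\<Sum>k\<le>n. blinfun_pow T k x)"
  by (simp add: cesaro_mean_def blinfun.sum_left blinfun.scaleR_left scaleR_sum_right)

lemma cesaro_mean_in_convex_hull: "cesaro_mean T n \<in> convex hull (range (blinfun_pow T))"
  unfolding cesaro_mean_def
  by (rule convex_sum) (auto simp: hull_inc)

lemma cesaro_mean_diff:
  "blinfun_apply (cesaro_mean T n) (x - T x) = (1 / real (Suc n)) *\<^sub>R (x - blinfun_pow T (Suc n) x)"
proof -
  have "(\<Sum>k\<le>n. blinfun_pow T k (x - T x)) = (\<Sum>k\<le>n. blinfun_pow T k x - blinfun_pow T (Suc k) x)"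
    by (simp add: blinfun.diff_right blinfun_pow_Suc_apply2)
  also have "\<dots> = x - blinfun_pow T (Suc n) x"
    by (subst sum_telescope) simp
  finally show ?thesis
    by (simp add: cesaro_mean_apply)
qed

lemma cesaro_mean_commute:
  "blinfun_apply T (cesaro_mean T n x) = cesaro_mean T n (T x)"
  by (simp add: cesaro_mean_apply blinfun.scaleR_right blinfun.sum_right
      blinfun_pow_Suc_apply[symmetric] blinfun_pow_Suc_apply2)

lemma cesaro_mean_fixed:
  fixes T :: "'a::real_normed_vector \<Rightarrow>\<^sub>L 'a"
  assumes "T x = x"
  shows "cesaro_mean T n x = x"
  by (simp add: cesaro_mean_apply blinfun_pow_fixed[OF assms] sum_constant_scaleR)

lemma norm_cesaro_mean_le:
  assumes "\<And>n. norm (blinfun_pow T n x) \<le> B"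
  shows "norm (cesaro_mean T n x) \<le> B"
proof -
  have "norm (cesaro_mean T n x) = norm (\<Sum>k\<le>n. blinfun_pow T k x) / real (Suc n)"
    by (simp add: cesaro_mean_apply)
  also have "\<dots> \<le> (real (Suc n) * B) / real (Suc n)"
    using sum_norm_bound[of "{..n}" "\<lambda>k. blinfun_pow T k x" B] assms
    by (intro divide_right_mono) auto
  finally show ?thesis
    by simp
qed

lemma cesaro_mean_tendsto_0:
  fixes T :: "'a::real_normed_vector \<Rightarrow>\<^sub>L 'a"
  assumes "power_bounded T" and x: "x \<in> closure (range (blinfun_apply (id_blinfun - T)))"
  shows "(\<lambda>n. cesaro_mean T n x) \<longlonglongrightarrow> 0"
proof (rule LIMSEQ_I)
  fix \<epsilon> :: real assume "0 < \<epsilon>"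
  obtain M where M: "1 \<le> M" "\<And>n x. norm (blinfun_pow T n x) \<le> M * norm x"
    using power_boundedE[OF assms(1)] by blast
  have "0 < \<epsilon> / (2 * M)"
    using \<open>0 < \<epsilon>\<close> M(1) by simp
  then obtain u where u: "dist (u - T u) x < \<epsilon> / (2 * M)"
    using x unfolding closure_approachable by (auto simp: blinfun.diff_left)
  have "(\<lambda>n. (1 / real (Suc n)) * ((M + 1) * norm u)) \<longlonglongrightarrow> 0"
    using tendsto_mult_left_zero[OF LIMSEQ_Suc[OF lim_1_over_n]] by simp
  then obtain n0 where n0: "\<And>n. n0 \<le> n \<Longrightarrow> (1 / real (Suc n)) * ((M + 1) * norm u) < \<epsilon>/2"
    using order_tendstoD(2)[of _ 0 sequentially "\<epsilon>/2"] \<open>0 < \<epsilon>\<close>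
    unfolding eventually_sequentially by (metis half_gt_zero)
  have "norm (cesaro_mean T n x) < \<epsilon>" if "n0 \<le> n" for n
  proof -
    have "norm (cesaro_mean T n (x - (u - T u))) \<le> M * norm (x - (u - T u))"
      by (intro norm_cesaro_mean_le M(2))
    also have "\<dots> < \<epsilon>/2"
      using u M(1) by (simp add: dist_norm norm_minus_commute field_simps)
    finally have 1: "norm (cesaro_mean T n (x - (u - T u))) < \<epsilon>/2" .
    have "norm (u - blinfun_pow T (Suc n) u) \<le> (M + 1) * norm u"
      using norm_triangle_ineq4[of u "blinfun_pow T (Suc n) u"] M(2)[of "Suc n" u]
      by (simp add: distrib_right)
    then have "norm (cesaro_mean T n (u - T u)) \<le> (1 / real (Suc n)) * ((M + 1) * norm u)"
      unfolding cesaro_mean_diff norm_scaleR by (intro mult_mono) auto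
    also have "\<dots> < \<epsilon>/2"
      by (rule n0[OF that])
    finally have 2: "norm (cesaro_mean T n (u - T u)) < \<epsilon>/2" .
    have "cesaro_mean T n x = cesaro_mean T n (x - (u - T u)) + cesaro_mean T n (u - T u)"
      by (simp add: blinfun.add_right[symmetric])
    then show ?thesis
      using norm_triangle_lt[of "cesaro_mean T n (x - (u - T u))" "cesaro_mean T n (u - T u)" \<epsilon>] 1 2
      by simp
  qed
  then show "\<exists>n0. \<forall>n\<ge>n0. norm (cesaro_mean T n x - 0) < \<epsilon>"
    by auto
qed

text \<open>
  A cluster point \<open>z\<close> of the means exists by compactness and is fixed since \<open>A\<^sub>n (x - T x) \<longlonglongrightarrow> 0\<close>. As
  \<open>x - z\<close> is a limit of vectors \<open>x - A\<^sub>n x\<close> in the range of \<open>I - T\<close>, the means of \<open>x - z\<close> tend to zero, which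
  turns the cluster point into a limit.
\<close>
lemma cesaro_mean_convergent:
  fixes T :: "'a::banach \<Rightarrow>\<^sub>L 'a"
  assumes "power_bounded T" and rc: "relatively_compact_orbit T x"
  obtains z where "(\<lambda>n. cesaro_mean T n x) \<longlonglongrightarrow> z" "T z = z"
proof -
  let ?C = "closure (convex hull (range (\<lambda>n. blinfun_pow T n x)))"
  let ?R = "range (blinfun_apply (id_blinfun - T))"
  have "seq_compact ?C"
    using compact_closure_convex_hull[OF rc] by (simp add: compact_eq_seq_compact_metric)
  moreover have "\<forall>n. cesaro_mean T n x \<in> ?C"
  proof
    fix n
    have "cesaro_mean T n x \<in> convex hull (range (\<lambda>n. blinfun_pow T n x))"
      unfolding cesaro_mean_def blinfun.sum_left blinfun.scaleR_left
      by (rule convex_sum) (auto simp: hull_inc)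
    then show "cesaro_mean T n x \<in> ?C"
      using closure_subset by blast
  qed
  ultimately obtain z r where r: "strict_mono (r :: nat \<Rightarrow> nat)"
    and z: "((\<lambda>n. cesaro_mean T n x) \<circ> r) \<longlonglongrightarrow> z"
    by (rule seq_compactE)
  have "x - T x \<in> closure ?R"
    using closure_subset[of ?R] by (auto simp: blinfun.diff_left intro!: subsetD[OF closure_subset] image_eqI[of _ _ x])
  from LIMSEQ_subseq_LIMSEQ[OF cesaro_mean_tendsto_0[OF assms(1) this] r]
  have "(\<lambda>n. cesaro_mean T (r n) (x - T x)) \<longlonglongrightarrow> 0"
    by (simp add: o_def)
  moreover have "(\<lambda>n. cesaro_mean T (r n) x - T (cesaro_mean T (r n) x)) \<longlonglongrightarrow> z - T z"
    using z by (intro tendsto_diff blinfun.tendsto tendsto_const) (simp_all add: o_def)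
  ultimately have "T z = z"
    using LIMSEQ_unique by (fastforce simp: blinfun.diff_right cesaro_mean_commute)
  have "x - z \<in> closure ?R"
    unfolding closure_sequential
  proof (intro exI conjI allI)
    show "x - cesaro_mean T (r n) x \<in> ?R" for n
      by (intro diff_convex_hull_pow_in_range cesaro_mean_in_convex_hull)
    show "(\<lambda>n. x - cesaro_mean T (r n) x) \<longlonglongrightarrow> x - z"
      using z by (intro tendsto_diff tendsto_const) (simp add: o_def)
  qed
  from tendsto_add[OF cesaro_mean_tendsto_0[OF assms(1) this] tendsto_const[of z]]
  have "(\<lambda>n. cesaro_mean T n x) \<longlonglongrightarrow> z"
    by (simp add: blinfun.diff_right cesaro_mean_fixed[OF \<open>T z = z\<close>])
  with \<open>T z = z\<close> show thesis
    using that by blast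
qed

lemma bounded_coperators_pow:
  assumes "T \<in> bounded_coperators"
  shows "blinfun_pow T n (c *\<^sub>C x) = c *\<^sub>C blinfun_pow T n x"
  using assms by (induction n) (simp_all add: bounded_coperators_def blinfun_pow_Suc_apply)

lemma cesaro_mean_scaleC:
  assumes "T \<in> bounded_coperators"
  shows "cesaro_mean T n (c *\<^sub>C x) = c *\<^sub>C cesaro_mean T n x"
  by (simp add: cesaro_mean_apply bounded_coperators_pow[OF assms] complex_vector.scale_sum_right[symmetric]
      scaleR_scaleC scaleC_scaleC mult.commute)

theorem mean_ergodic_if_relatively_compact_orbits:
  fixes T :: "'a::complex_banach \<Rightarrow>\<^sub>L 'a"
  assumes T: "T \<in> bounded_coperators" "power_bounded T"
    and "relatively_compact_orbits_on T UNIV"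
  shows "mean_ergodic T"
proof -
  obtain M where M: "1 \<le> M" "\<And>n x. norm (blinfun_pow T n x) \<le> M * norm x"
    using power_boundedE[OF assms(2)] by blast
  have "\<exists>z. (\<lambda>n. cesaro_mean T n x) \<longlonglongrightarrow> z \<and> T z = z" for x
  proof -
    have "relatively_compact_orbit T x"
      using assms(3) by (simp add: relatively_compact_orbits_on_def)
    then show ?thesis
      using cesaro_mean_convergent[OF T(2)] by metis
  qed
  then obtain p where p: "\<And>x. (\<lambda>n. cesaro_mean T n x) \<longlonglongrightarrow> p x" "\<And>x. T (p x) = p x"
    by metis
  have "bounded_linear p"
  proof (rule bounded_linear_intro)
    show "p (x + y) = p x + p y" for x y
      using LIMSEQ_unique[OF p(1)[of "x + y"]] tendsto_add[OF p(1)[of x] p(1)[of y]]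
      by (simp add: blinfun.add_right)
    show "p (t *\<^sub>R x) = t *\<^sub>R p x" for t x
      using LIMSEQ_unique[OF p(1)[of "t *\<^sub>R x"]] tendsto_scaleR[OF tendsto_const p(1)[of x], of t]
      by (simp add: blinfun.scaleR_right)
    show "norm (p x) \<le> norm x * M" for x
    proof (rule tendsto_upperbound[OF tendsto_norm[OF p(1)]])
      show "\<forall>\<^sub>F n in sequentially. norm (cesaro_mean T n x) \<le> norm x * M"
        using norm_cesaro_mean_le[OF M(2)] by (simp add: mult.commute)
    qed simp
  qed
  then have P: "blinfun_apply (Blinfun p) = p"
    by (rule bounded_linear_Blinfun_apply)
  have "Blinfun p \<in> bounded_coperators"
    unfolding bounded_coperators_def mem_Collect_eq P
  proof (intro allI)
    fix c x
    have "(\<lambda>n. cesaro_mean T n (c *\<^sub>C x)) \<longlonglongrightarrow> c *\<^sub>C p x"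
      unfolding cesaro_mean_scaleC[OF T(1)]
      by (rule bounded_linear.tendsto[OF bounded_linear_scaleC_right p(1)])
    then show "p (c *\<^sub>C x) = c *\<^sub>C p x"
      by (rule LIMSEQ_unique[OF p(1)])
  qed
  moreover have "Blinfun p \<in> strong_operator_topology closure_of (convex hull (range (blinfun_pow T)))"
    by (rule strong_operator_closureI[where S = "cesaro_mean T", OF cesaro_mean_in_convex_hull])
      (simp add: P p(1))
  moreover have "p (p x) = p x" for x
    using LIMSEQ_unique[OF p(1)[of "p x"]] by (simp add: cesaro_mean_fixed[OF p(2)])
  then have "Blinfun p o\<^sub>L Blinfun p = Blinfun p"
    by (intro blinfun_eqI) (simp add: P)
  moreover have "p (T x) = p x" for x
    using LIMSEQ_unique[OF p(1)[of "T x"]] blinfun.tendsto[OF tendsto_const p(1)[of x], of T]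
    by (simp add: cesaro_mean_commute p(2))
  then have "Blinfun p o\<^sub>L T = Blinfun p"
    by (intro blinfun_eqI) (simp add: P)
  moreover have "T o\<^sub>L Blinfun p = Blinfun p"
    by (intro blinfun_eqI) (simp add: P p(2))
  ultimately show ?thesis
    unfolding mean_ergodic_def by blast
qed

text \<open>
  The powers of the inverse bring \<open>T\<^sup>n x\<close> back to \<open>x\<close>, so a bound on them is a lower bound for \<open>T\<^sup>n x\<close>.
\<close>
lemma doubly_power_bounded_imp:
  assumes "doubly_power_bounded T"
  shows "power_bounded T" "power_bounded_below T"
proof -
  obtain S where S: "S o\<^sub>L T = id_blinfun" "power_bounded S" "power_bounded T"
    using assms by (auto simp: doubly_power_bounded_def)
  show "power_bounded T"
    by (rule S)
  obtain M where M: "1 \<le> M" "\<And>n x. norm (blinfun_pow S n x) \<le> M * norm x"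
    using power_boundedE[OF S(2)] by blast
  have ST: "S (T x) = x" for x
    using S(1) by (metis blinfun_apply_blinfun_compose blinfun_apply_id_blinfun id_apply)
  have inv: "blinfun_pow S n (blinfun_pow T n x) = x" for n x
    by (induction n) (simp_all add: blinfun_pow_Suc_apply[of T] blinfun_pow_Suc_apply2[of S] ST)
  show "power_bounded_below T"
    unfolding power_bounded_below_def
  proof (intro allI impI)
    fix x :: 'a assume "x \<noteq> 0"
    have "norm x / M \<le> norm (blinfun_pow T n x)" for n
      using M(2)[of n "blinfun_pow T n x"] M(1) by (simp add: inv field_simps)
    then have "norm x / M \<le> (INF n. norm (blinfun_pow T n x))"
      by (intro cINF_greatest) auto
    moreover have "0 < norm x / M"
      using \<open>x \<noteq> 0\<close> M(1) by simp
    ultimately show "0 < (INF n. norm (blinfun_pow T n x))"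
      by linarith
  qed
qed

section \<open>Sobczyk's theorem\<close>

lemma diagonal_convergent_subsequence:
  fixes w :: "nat \<Rightarrow> nat \<Rightarrow> real"
  assumes "\<And>k j. \<bar>w k j\<bar> \<le> b j"
  obtains r where "strict_mono r" "\<And>j. convergent (\<lambda>k. w (r k) j)"
proof -
  interpret subseqs "\<lambda>j s. convergent (\<lambda>k. w (s k) j)"
  proof
    fix j and s :: "nat \<Rightarrow> nat"
    have "seq_compact {- b j..b j}"
      by (simp add: compact_imp_seq_compact)
    moreover have "\<forall>k. w (s k) j \<in> {- b j..b j}"
      using assms by (simp add: abs_le_iff minus_le_iff)
    ultimately obtain l r where "strict_mono (r :: nat \<Rightarrow> nat)" "((\<lambda>k. w (s k) j) \<circ> r) \<longlonglongrightarrow> l"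
      by (rule seq_compactE)
    then show "\<exists>r. strict_mono r \<and> convergent (\<lambda>k. w ((s \<circ> r) k) j)"
      by (auto simp: o_def convergent_def)
  qed
  have "convergent (\<lambda>k. w (diagseq k) j)" for j
  proof -
    have "convergent (\<lambda>k. w ((diagseq \<circ> (+) (Suc j)) k) j)"
    proof (rule diagseq_holds)
      fix r s :: "nat \<Rightarrow> nat" and n
      assume "strict_mono r" "convergent (\<lambda>k. w (s k) n)"
      then show "convergent (\<lambda>k. w ((s \<circ> r) k) n)"
        using convergent_subseq_convergent[of "\<lambda>k. w (s k) n" r] by (simp add: o_def)
    qed
    then show ?thesis
      using convergent_ignore_initial_segment[of "\<lambda>k. w (diagseq k) j" "Suc j"]
      by (simp add: o_def add.commute)
  qed
  then show thesis
    using that subseq_diagseq by blast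
qed

lemma functional_diff_le:
  fixes h :: "'a::real_normed_vector \<Rightarrow> real"
  assumes "linear h" "\<And>x. \<bar>h x\<bar> \<le> C * norm x"
  shows "\<bar>h x - h y\<bar> \<le> C * dist x y"
  using assms(2)[of "x - y"] by (simp add: linear_diff[OF assms(1)] dist_norm)

lemma functionals_convergent_on_closure:
  fixes h :: "nat \<Rightarrow> 'a::real_normed_vector \<Rightarrow> real"
  assumes h: "\<And>n. linear (h n)" "\<And>n x. \<bar>h n x\<bar> \<le> C * norm x"
    and D: "\<And>d. d \<in> D \<Longrightarrow> convergent (\<lambda>n. h n d)" and x: "x \<in> closure D"
  shows "convergent (\<lambda>n. h n x)"
proof -
  have "Cauchy (\<lambda>n. h n x)"
  proof (rule metric_CauchyI)
    fix e :: real assume "0 < e"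
    have "0 < e / (3 * (\<bar>C\<bar> + 1))"
      using \<open>0 < e\<close> by simp
    then obtain d where d: "d \<in> D" "dist d x < e / (3 * (\<bar>C\<bar> + 1))"
      using x unfolding closure_approachable by blast
    have near: "\<bar>h n x - h n d\<bar> < e/3" for n
    proof -
      have "\<bar>h n x - h n d\<bar> \<le> C * dist x d"
        by (rule functional_diff_le[OF h])
      also have "\<dots> \<le> (\<bar>C\<bar> + 1) * dist x d"
        by (intro mult_right_mono) auto
      also have "\<dots> < e/3"
        using d(2) by (simp add: dist_commute field_simps)
      finally show ?thesis .
    qed
    have "Cauchy (\<lambda>n. h n d)"
      using D[OF d(1)] by (rule convergent_Cauchy)
    then obtain N where N: "\<And>m n. N \<le> m \<Longrightarrow> N \<le> n \<Longrightarrow> dist (h m d) (h n d) < e/3"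
      using metric_CauchyD[of "\<lambda>n. h n d" "e/3"] \<open>0 < e\<close> by auto
    have "dist (h m x) (h n x) < e" if "N \<le> m" "N \<le> n" for m n
      using near[of m] near[of n] N[OF that] unfolding dist_real_def by linarith
    then show "\<exists>N. \<forall>m\<ge>N. \<forall>n\<ge>N. dist (h m x) (h n x) < e"
      by blast
  qed
  then show ?thesis
    by (simp add: Cauchy_convergent_iff)
qed

lemma functionals_tendsto_0_on_closure:
  fixes h :: "nat \<Rightarrow> 'a::real_normed_vector \<Rightarrow> real"
  assumes h: "\<And>n. linear (h n)" "\<And>n x. \<bar>h n x\<bar> \<le> C * norm x"
    and D: "\<And>d. d \<in> D \<Longrightarrow> (\<lambda>n. h n d) \<longlonglongrightarrow> 0" and x: "x \<in> closure D"
  shows "(\<lambda>n. h n x) \<longlonglongrightarrow> 0"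
proof -
  obtain l where l: "(\<lambda>n. h n x) \<longlonglongrightarrow> l"
    using functionals_convergent_on_closure[where h = h, OF h _ x] D unfolding convergent_def by blast
  have "\<bar>l\<bar> \<le> C * dist x d" if "d \<in> D" for d
  proof (rule tendsto_upperbound)
    show "(\<lambda>n. \<bar>h n x - h n d\<bar>) \<longlonglongrightarrow> \<bar>l\<bar>"
      using tendsto_rabs[OF tendsto_diff[OF l D[OF that]]] by simp
    show "\<forall>\<^sub>F n in sequentially. \<bar>h n x - h n d\<bar> \<le> C * dist x d"
      using functional_diff_le[OF h] by simp
  qed simp
  moreover obtain d where d: "\<And>n. d n \<in> D" "d \<longlonglongrightarrow> x"
    using x unfolding closure_sequential by blast
  ultimately have "\<bar>l\<bar> \<le> C * dist x (d n)" for n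
    by blast
  moreover have "(\<lambda>n. C * dist x (d n)) \<longlonglongrightarrow> C * dist x x"
    by (intro tendsto_intros d)
  ultimately have "\<bar>l\<bar> \<le> C * dist x x"
    using LIMSEQ_le_const[of "\<lambda>n. C * dist x (d n)" "C * dist x x" "\<bar>l\<bar>"] by blast
  then show ?thesis
    using l by simp
qed

text \<open>
  Veech's argument. Let \<open>K\<close> be the set of functionals with bound \<open>B\<close> that vanish on \<open>F\<close>. Pointwise
  limits of subsequences of \<open>v\<close> lie in \<open>K\<close>, and by separability every subsequence has a further
  subsequence with a pointwise limit. So on finitely many points of a dense sequence \<open>v\<^sub>n\<close> is eventually
  close to some element of \<open>K\<close>. Letting the number of points and the precision grow slowly with \<open>n\<close>
  gives the functionals \<open>\<psi>\<^sub>n\<close>.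
\<close>
lemma weak_star_null_modulo_annihilator:
  fixes v :: "nat \<Rightarrow> 'a::real_normed_vector \<Rightarrow> real"
  assumes sep: "separable_space (euclidean :: 'a topology)"
    and v: "\<And>n. linear (v n)" "\<And>n x. \<bar>v n x\<bar> \<le> B * norm x"
    and null: "\<And>y. y \<in> F \<Longrightarrow> (\<lambda>n. v n y) \<longlonglongrightarrow> 0"
  obtains \<psi> where "\<And>n. linear (\<psi> n)" "\<And>n x. \<bar>\<psi> n x\<bar> \<le> B * norm x"
    "\<And>n y. y \<in> F \<Longrightarrow> \<psi> n y = 0" "\<And>x. (\<lambda>n. v n x - \<psi> n x) \<longlonglongrightarrow> 0"
proof -
  define K where "K = {\<psi>. linear \<psi> \<and> (\<forall>x. \<bar>\<psi> x\<bar> \<le> B * norm x) \<and> (\<forall>y\<in>F. \<psi> y = 0)}"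
  obtain D :: "'a set" where D: "countable D" "closure D = UNIV"
    using sep by (auto simp: separable_space_def)
  then have "D \<noteq> {}"
    by auto
  define d where "d = from_nat_into D"
  have d: "range d = D"
    unfolding d_def by (rule range_from_nat_into[OF \<open>D \<noteq> {}\<close> D(1)])
  define close where "close = (\<lambda>m n \<psi>. \<forall>j<m. \<bar>v n (d j) - \<psi> (d j)\<bar> < 1 / real (Suc m))"
  have near: "\<forall>\<^sub>F n in sequentially. \<exists>\<psi>\<in>K. close m n \<psi>" for m
  proof (rule ccontr)
    assume "\<not> (\<forall>\<^sub>F n in sequentially. \<exists>\<psi>\<in>K. close m n \<psi>)"
    then have "infinite {n. \<not> (\<exists>\<psi>\<in>K. close m n \<psi>)}"
      unfolding cofinite_eq_sequentially[symmetric] eventually_cofinite .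
    then obtain s :: "nat \<Rightarrow> nat" where s: "strict_mono s" "\<And>k. \<not> (\<exists>\<psi>\<in>K. close m (s k) \<psi>)"
      using infinite_enumerate by blast
    obtain r where r: "strict_mono r" "\<And>j. convergent (\<lambda>k. v (s (r k)) (d j))"
      using diagonal_convergent_subsequence[of "\<lambda>k j. v (s k) (d j)" "\<lambda>j. B * norm (d j)"] v(2) by blast
    have "convergent (\<lambda>k. v (s (r k)) x)" for x
      using functionals_convergent_on_closure[of "\<lambda>k. v (s (r k))" B D x] v r(2) d D(2) by auto
    then obtain \<psi> where \<psi>: "\<And>x. (\<lambda>k. v (s (r k)) x) \<longlonglongrightarrow> \<psi> x"
      unfolding convergent_def by metis
    have "\<psi> \<in> K"
      unfolding K_def mem_Collect_eq
    proof (intro conjI allI ballI)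
      show "linear \<psi>"
      proof
        fix x y :: 'a and t :: real
        show "\<psi> (x + y) = \<psi> x + \<psi> y"
          using LIMSEQ_unique[OF \<psi>[of "x + y"]] tendsto_add[OF \<psi>[of x] \<psi>[of y]]
          by (simp add: linear_add[OF v(1)])
        show "\<psi> (t *\<^sub>R x) = t *\<^sub>R \<psi> x"
          using LIMSEQ_unique[OF \<psi>[of "t *\<^sub>R x"]] tendsto_mult_left[OF \<psi>[of x], of t]
          by (simp add: linear_scale[OF v(1)])
      qed
      show "\<bar>\<psi> x\<bar> \<le> B * norm x" for x
        by (rule tendsto_upperbound[OF tendsto_rabs[OF \<psi>]]) (use v(2) in simp_all)
      show "\<psi> y = 0" if "y \<in> F" for y
        using LIMSEQ_unique[OF \<psi>] LIMSEQ_subseq_LIMSEQ[OF null[OF that] strict_mono_o[OF s(1) r(1)]]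
        by (simp add: o_def)
    qed
    moreover have "\<forall>\<^sub>F k in sequentially. \<forall>j\<in>{..<m}. dist (v (s (r k)) (d j)) (\<psi> (d j)) < 1 / real (Suc m)"
      by (intro eventually_ball_finite ballI tendstoD[OF \<psi>]) auto
    then obtain k where "close m (s (r k)) \<psi>"
      by (auto simp: eventually_sequentially close_def dist_real_def)
    ultimately show False
      using s(2) by blast
  qed
  \<comment> \<open>The cut-off \<open>m \<le> n\<close> keeps the maximum finite; \<open>m = 0\<close> imposes no condition, so the set is never empty.\<close>
  define M where "M = (\<lambda>n. Max {m. m \<le> n \<and> (\<exists>\<psi>\<in>K. close m n \<psi>)})"
  have "0 \<le> B * norm x" for x :: 'a
    using v(2)[of 0 x] by linarith
  then have "(\<lambda>x. 0) \<in> K"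
    by (simp add: K_def linear_iff)
  then have ne: "0 \<in> {m. m \<le> n \<and> (\<exists>\<psi>\<in>K. close m n \<psi>)}" for n
    by (auto simp: close_def)
  have fin: "finite {m. m \<le> n \<and> (\<exists>\<psi>\<in>K. close m n \<psi>)}" for n
    by simp
  have "\<exists>\<psi>\<in>K. close (M n) n \<psi>" for n
    using Max_in[OF fin[of n]] ne[of n] unfolding M_def by blast
  then obtain \<psi> where \<psi>: "\<And>n. \<psi> n \<in> K" "\<And>n. close (M n) n (\<psi> n)"
    by metis
  have M_large: "\<forall>\<^sub>F n in sequentially. m \<le> M n" for m
    using near[of m] eventually_ge_at_top[of m]
  proof eventually_elim
    case (elim n)
    then show ?case
      unfolding M_def by (intro Max_ge fin) auto
  qed
  have lin: "linear (\<lambda>x. v n x - \<psi> n x)" for n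
    using \<psi>(1)[of n] by (intro linear_compose_sub v) (simp add: K_def)
  have bound: "\<bar>v n x - \<psi> n x\<bar> \<le> (2 * B) * norm x" for n x
  proof -
    have "\<bar>\<psi> n x\<bar> \<le> B * norm x"
      using \<psi>(1)[of n] by (simp add: K_def)
    then show ?thesis
      using v(2)[of n x] by linarith
  qed
  have dense: "(\<lambda>n. v n (d j) - \<psi> n (d j)) \<longlonglongrightarrow> 0" for j
  proof (rule tendstoI)
    fix e :: real assume "0 < e"
    then obtain m0 where m0: "inverse (real (Suc m0)) < e"
      using reals_Archimedean by blast
    show "\<forall>\<^sub>F n in sequentially. dist (v n (d j) - \<psi> n (d j)) 0 < e"
      using M_large[of "max m0 (Suc j)"]
    proof eventually_elim
      case (elim n)
      then have "\<bar>v n (d j) - \<psi> n (d j)\<bar> < 1 / real (Suc (M n))"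
        using \<psi>(2)[of n] by (simp add: close_def)
      also have "\<dots> \<le> inverse (real (Suc m0))"
        using elim by (simp add: inverse_eq_divide frac_le)
      finally show ?case
        using m0 by simp
    qed
  qed
  show thesis
  proof (rule that[of \<psi>])
    show "(\<lambda>n. v n x - \<psi> n x) \<longlonglongrightarrow> 0" for x
      using functionals_tendsto_0_on_closure[of "\<lambda>n x. v n x - \<psi> n x" "2 * B" D x] lin bound
        dense d D(2) by auto
  qed (use \<psi>(1) in \<open>auto simp: K_def\<close>)
qed

lemma positively_homogeneous_bounded:
  fixes h :: "'a::real_normed_vector \<Rightarrow> 'b::real_normed_vector"
  assumes "continuous_on S h" and "0 \<in> S" "h 0 = 0"
    and S: "\<And>t x. x \<in> S \<Longrightarrow> 0 < t \<Longrightarrow> t *\<^sub>R x \<in> S"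
    and hom: "\<And>t x. x \<in> S \<Longrightarrow> 0 < t \<Longrightarrow> h (t *\<^sub>R x) = t *\<^sub>R h x"
  obtains C where "0 < C" "\<And>x. x \<in> S \<Longrightarrow> norm (h x) \<le> C * norm x"
proof -
  obtain \<delta> where \<delta>: "0 < \<delta>" "\<And>x. x \<in> S \<Longrightarrow> dist x 0 < \<delta> \<Longrightarrow> dist (h x) (h 0) < 1"
    using assms(1,2) unfolding continuous_on_iff by (metis zero_less_one)
  have "norm (h x) \<le> (2/\<delta>) * norm x" if "x \<in> S" for x
  proof (cases "x = 0")
    case False
    define t where "t = \<delta> / (2 * norm x)"
    have "0 < t"
      using \<delta>(1) False by (simp add: t_def)
    have "norm (t *\<^sub>R x) < \<delta>"
      using \<delta>(1) False by (simp add: t_def)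
    then have "norm (h (t *\<^sub>R x)) < 1"
      using \<delta>(2)[OF S[OF that \<open>0 < t\<close>]] assms(3) by simp
    then have "t * norm (h x) < 1"
      using hom[OF that \<open>0 < t\<close>] \<open>0 < t\<close> by simp
    then show ?thesis
      using \<delta>(1) False by (simp add: t_def field_simps)
  qed (simp add: assms(3))
  then show thesis
    using that[of "2/\<delta>"] \<delta>(1) by simp
qed

text \<open>
  Continuity of a linear homeomorphism and of its inverse at zero gives the two-sided norm estimate.
\<close>
lemma contains_copy_of_c0E:
  assumes "contains_copy_of_c0 TYPE('a::complex_normed_vector)"
  obtains f :: "(nat \<Rightarrow>\<^sub>C complex) \<Rightarrow> 'a::complex_normed_vector" and b C where "clinear_on c0 f"
    "0 < b" "0 < C" "\<And>a. a \<in> c0 \<Longrightarrow> norm a \<le> b * norm (f a)" "\<And>a. a \<in> c0 \<Longrightarrow> norm (f a) \<le> C * norm a"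
proof -
  obtain F f and g :: "'a \<Rightarrow> nat \<Rightarrow>\<^sub>C complex" where lin: "clinear_on c0 f" and hom: "homeomorphism c0 F f g"
    using assms by (auto simp: contains_copy_of_c0_def)
  have scale: "t *\<^sub>R a \<in> c0" "f (t *\<^sub>R a) = t *\<^sub>R f a" if "a \<in> c0" for t a
    using that by (simp_all add: clinear_on_c0D(2)[OF lin] c0_scaleC scaleR_scaleC)
  note zero = zero_in_c0 and f0 = clinear_on_c0D(3)[OF lin]
  have gf: "g (f a) = a" if "a \<in> c0" for a
    using hom that by (simp add: homeomorphism_def)
  have F: "F = f ` c0"
    using hom by (simp add: homeomorphism_def)
  obtain C where C: "0 < C" "\<And>a. a \<in> c0 \<Longrightarrow> norm (f a) \<le> C * norm a"
    using positively_homogeneous_bounded[OF _ zero f0 scale] hom by (metis homeomorphism_def)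
  obtain b where b: "0 < b" "\<And>y. y \<in> F \<Longrightarrow> norm (g y) \<le> b * norm y"
  proof (rule positively_homogeneous_bounded)
    show "continuous_on F g"
      using hom by (simp add: homeomorphism_def)
    show "0 \<in> F" "g 0 = 0"
      using zero f0 gf[OF zero] by (auto simp: F intro: image_eqI[of _ _ 0])
    fix t :: real and y assume "y \<in> F"
    then obtain a where a: "a \<in> c0" "y = f a"
      by (auto simp: F)
    have "t *\<^sub>R y = f (t *\<^sub>R a)"
      using scale(2)[OF a(1)] a(2) by simp
    then show "t *\<^sub>R y \<in> F" "g (t *\<^sub>R y) = t *\<^sub>R g y"
      using scale(1)[OF a(1)] gf a by (auto simp: F)
  qed blast
  show thesis
    using that[OF lin b(1) C(1) _ C(2)] b(2) gf by (metis F image_eqI)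
qed

lemma nat_bcontfunI:
  fixes f :: "nat \<Rightarrow> 'a::real_normed_vector"
  assumes "\<And>k. norm (f k) \<le> b"
  shows "f \<in> bcontfun"
  using assms by (intro bcontfun_normI) auto

lemma apply_Bcontfun_nat:
  fixes f :: "nat \<Rightarrow> 'a::real_normed_vector"
  assumes "\<And>k. norm (f k) \<le> b"
  shows "apply_bcontfun (Bcontfun f) = f"
  using nat_bcontfunI[OF assms] by (rule Bcontfun_inverse)

text \<open>
  The coordinates of the inverse of \<open>f\<close> extend to bounded functionals on the whole space. They need not
  tend to zero off the image of \<open>f\<close>; subtracting suitable functionals that vanish on the image
  repairs this without changing the coordinates. All of this is done for real parts, and the complex
  functional with real part \<open>h\<close> is \<open>x \<mapsto> h x - \<i> h (\<i> x)\<close>, which costs a factor in the norm.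
\<close>
theorem sobczyk:
  fixes f :: "(nat \<Rightarrow>\<^sub>C complex) \<Rightarrow> 'a::complex_normed_vector"
  assumes sep: "separable_space (euclidean :: 'a topology)"
    and lin: "clinear_on c0 f" and "0 < b" and low: "\<And>a. a \<in> c0 \<Longrightarrow> norm a \<le> b * norm (f a)"
  obtains Q :: "'a \<Rightarrow> nat \<Rightarrow>\<^sub>C complex" where
    "\<And>x y. Q (x + y) = Q x + Q y" "\<And>c x. Q (c *\<^sub>C x) = c *\<^sub>C Q x"
    "\<And>x. norm (Q x) \<le> 4 * b * norm x" "\<And>x. Q x \<in> c0" "\<And>a. a \<in> c0 \<Longrightarrow> Q (f a) = a"
proof -
  note f_add = clinear_on_c0D(1)[OF lin] and f_scale = clinear_on_c0D(2)[OF lin]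
  have inj: "inj_on f c0"
  proof (rule inj_onI)
    fix x y assume xy: "x \<in> c0" "y \<in> c0" "f x = f y"
    have "f (x + (-1) *\<^sub>C y) = f x + (-1) *\<^sub>C f y"
      by (simp only: f_add f_scale c0_scaleC xy(1,2))
    also have "\<dots> = 0"
      using xy(3) by simp
    finally have "f (x + (-1) *\<^sub>C y) = 0" .
    moreover have "norm (x + (-1) *\<^sub>C y) \<le> b * norm (f (x + (-1) *\<^sub>C y))"
      by (intro low c0_add c0_scaleC xy)
    ultimately have "norm (x + (-1) *\<^sub>C y) \<le> b * norm (0 :: 'a)"
      by (simp only:)
    then show "x = y"
      by simp
  qed
  define g where "g = inv_into c0 f"
  have gf: "g (f a) = a" if "a \<in> c0" for a
    using inj that by (simp add: g_def)
  have "\<exists>v. linear v \<and> (\<forall>a\<in>c0. v (f a) = Re (a n)) \<and> (\<forall>x. \<bar>v x\<bar> \<le> b * norm x)" for n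
  proof -
    have sub: "subspace (f ` c0)"
      unfolding subspace_def
    proof (intro conjI ballI allI)
      show "0 \<in> f ` c0"
        using clinear_on_c0D(3)[OF lin] zero_in_c0 by (metis image_eqI)
    next
      fix y z assume "y \<in> f ` c0" "z \<in> f ` c0"
      then show "y + z \<in> f ` c0"
        using f_add c0_add by (metis (no_types, opaque_lifting) image_iff)
    next
      fix t y assume "y \<in> f ` c0"
      then show "t *\<^sub>R y \<in> f ` c0"
        using f_scale c0_scaleC unfolding scaleR_scaleC by (metis (no_types, opaque_lifting) image_iff)
    qed
    obtain v where v: "linear v" "\<And>y. y \<in> f ` c0 \<Longrightarrow> v y = Re (g y n)" "\<And>x. v x \<le> b * norm x"
    proof (rule hahn_banach_sublinear[of "\<lambda>x. b * norm x" "f ` c0" "\<lambda>y. Re (g y n)"])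
      show "b * norm (x + y) \<le> b * norm x + b * norm y" for x y :: 'a
        using \<open>0 < b\<close> norm_triangle_ineq[of x y] by (simp flip: distrib_left)
      show "b * norm (t *\<^sub>R x) = t * (b * norm x)" if "0 < t" for t and x :: 'a
        using that by simp
      show "Re (g (x + y) n) = Re (g x n) + Re (g y n)" if "x \<in> f ` c0" "y \<in> f ` c0" for x y
        using that gf c0_add by (auto simp flip: f_add)
      show "Re (g (t *\<^sub>R x) n) = t * Re (g x n)" if "x \<in> f ` c0" for t x
        using that gf c0_scaleC
        by (auto simp: scaleR_scaleC apply_bcontfun_scaleC scaleC_complex_def simp flip: f_scale)
      show "Re (g x n) \<le> b * norm x" if "x \<in> f ` c0" for x
      proof -
        obtain a where a: "a \<in> c0" "x = f a"
          using \<open>x \<in> f ` c0\<close> by blast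
        have "Re (a n) \<le> norm (a n)"
          by (rule complex_Re_le_cmod)
        also have "\<dots> \<le> norm a"
          by (rule norm_bounded)
        also have "\<dots> \<le> b * norm x"
          using low[OF a(1)] a(2) by simp
        finally show ?thesis
          using gf[OF a(1)] a(2) by simp
      qed
      show "subspace (f ` c0)"
        by (rule sub)
    qed blast
    have "\<bar>v x\<bar> \<le> b * norm x" for x
      using v(3)[of x] v(3)[of "- x"] linear_neg[OF v(1), of x] by simp
    then show ?thesis
      using v(1,2) gf by (metis image_eqI)
  qed
  then obtain v where v: "\<And>n. linear (v n)" "\<And>n a. a \<in> c0 \<Longrightarrow> v n (f a) = Re (a n)"
      "\<And>n x. \<bar>v n x\<bar> \<le> b * norm x"
    by metis
  have null: "(\<lambda>n. v n y) \<longlonglongrightarrow> 0" if "y \<in> f ` c0" for y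
    using that v(2) tendsto_Re[of _ "0::complex"] by (auto simp: c0_def)
  obtain \<psi> where \<psi>: "\<And>n. linear (\<psi> n)" "\<And>n x. \<bar>\<psi> n x\<bar> \<le> b * norm x"
      "\<And>n y. y \<in> f ` c0 \<Longrightarrow> \<psi> n y = 0" "\<And>x. (\<lambda>n. v n x - \<psi> n x) \<longlonglongrightarrow> 0"
    using weak_star_null_modulo_annihilator[OF sep v(1,3) null] by blast
  define h where "h = (\<lambda>n x. v n x - \<psi> n x)"
  have h: "linear (h n)" "\<bar>h n x\<bar> \<le> (2 * b) * norm x" "(\<lambda>n. h n x) \<longlonglongrightarrow> 0" for n x
    using linear_compose_sub[OF v(1) \<psi>(1), of n n] v(3)[of n x] \<psi>(2)[of n x] \<psi>(4)[of x]
    by (auto simp: h_def)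
  have hf: "h n (f a) = Re (a n)" if "a \<in> c0" for n a
    using that by (simp add: h_def v(2) \<psi>(3))
  define \<phi> where "\<phi> = (\<lambda>n x. Complex (h n x) (- h n (\<i> *\<^sub>C x)))"
  have \<phi>_bound: "norm (\<phi> n x) \<le> 4 * b * norm x" for n x
    using cmod_le[of "\<phi> n x"] h(2)[of n x] h(2)[of n "\<i> *\<^sub>C x"] by (simp add: \<phi>_def norm_scaleC)
  have \<phi>_null: "(\<lambda>n. \<phi> n x) \<longlonglongrightarrow> 0" for x
    using tendsto_Complex[OF h(3)[of x] tendsto_minus[OF h(3)[of "\<i> *\<^sub>C x"]]]
    by (simp add: \<phi>_def zero_complex.code)
  have \<phi>_add: "\<phi> n (x + y) = \<phi> n x + \<phi> n y" for n x y
    by (simp add: \<phi>_def linear_add[OF h(1)] scaleC_add_right complex_eq_iff)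
  have \<phi>_scale: "\<phi> n (c *\<^sub>C x) = c * \<phi> n x" for n c x
  proof -
    have ic: "\<i> *\<^sub>C c *\<^sub>C x = Re c *\<^sub>R \<i> *\<^sub>C x - Im c *\<^sub>R x"
    proof -
      have "\<i> *\<^sub>C c *\<^sub>C x = (\<i> * c) *\<^sub>C x"
        by (rule scaleC_scaleC)
      also have "\<dots> = Re (\<i> * c) *\<^sub>R x + Im (\<i> * c) *\<^sub>R \<i> *\<^sub>C x"
        by (rule scaleC_Re_Im)
      finally show ?thesis
        by simp
    qed
    show ?thesis
      unfolding \<phi>_def ic unfolding scaleC_Re_Im[of c x]
      by (simp add: complex_eq_iff linear_add[OF h(1)] linear_diff[OF h(1)] linear_scale[OF h(1)])
  qed
  define Q where "Q = (\<lambda>x. Bcontfun (\<lambda>n. \<phi> n x))"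
  have Q: "Q x n = \<phi> n x" for x n
    unfolding Q_def by (subst apply_Bcontfun_nat[OF \<phi>_bound]) (rule refl)
  show thesis
  proof (rule that[of Q])
    show "Q (x + y) = Q x + Q y" for x y
      by (rule bcontfun_eqI) (simp add: Q \<phi>_add)
    show "Q (c *\<^sub>C x) = c *\<^sub>C Q x" for c x
      by (rule bcontfun_eqI) (simp add: Q \<phi>_scale apply_bcontfun_scaleC scaleC_complex_def)
    show "norm (Q x) \<le> 4 * b * norm x" for x
      by (rule norm_bound) (simp add: Q \<phi>_bound)
    show "Q x \<in> c0" for x
      using \<phi>_null[of x] by (simp add: c0_def flip: Q)
    show "Q (f a) = a" if "a \<in> c0" for a
    proof (rule bcontfun_eqI)
      fix n
      have "h n (\<i> *\<^sub>C f a) = - Im (a n)"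
        using hf[OF c0_scaleC[OF that], of n \<i>]
        by (simp add: f_scale[OF that] apply_bcontfun_scaleC scaleC_complex_def)
      then show "Q (f a) n = a n"
        by (simp add: Q \<phi>_def hf[OF that] complex_eq_iff)
    qed
  qed
qed

section \<open>A rotation that is not mean ergodic\<close>

text \<open>
  A null sequence \<open>y\<close> encodes the convergent sequence with limit \<open>y 0\<close> and entries \<open>y k + y 0\<close> for \<open>k > 0\<close>.
  On convergent sequences \<open>R\<^sub>t\<close> multiplies the \<open>k\<close>-th entry by \<open>cis (t / k)\<close>, and the function below is
  \<open>R\<^sub>t - I\<close> in this encoding. The coordinate \<open>0\<close> needs no separate treatment: \<open>t / 0 = 0\<close>, so the factor
  there is zero, as it should be because rotations preserve limits.
\<close>
definition rotation_part :: "real \<Rightarrow> (nat \<Rightarrow>\<^sub>C complex) \<Rightarrow> nat \<Rightarrow>\<^sub>C complex" where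
  "rotation_part t y = Bcontfun (\<lambda>k. (cis (t / real k) - 1) * (y k + y 0))"

lemma norm_rotation_part_coordinate_le:
  "norm ((cis t - 1) * (y k + y 0)) \<le> 4 * norm y" for y :: "nat \<Rightarrow>\<^sub>C complex"
proof -
  have "norm (cis t - 1) \<le> 2"
    using norm_triangle_ineq4[of "cis t" 1] by simp
  moreover have "norm (y k + y 0) \<le> 2 * norm y"
    using norm_triangle_ineq[of "y k" "y 0"] norm_bounded[of y k] norm_bounded[of y 0] by linarith
  ultimately have "norm (cis t - 1) * norm (y k + y 0) \<le> 2 * (2 * norm y)"
    by (intro mult_mono) auto
  then show ?thesis
    by (simp add: norm_mult)
qed

lemma rotation_part_apply:
  "rotation_part t y k = (cis (t / real k) - 1) * (y k + y 0)"
  unfolding rotation_part_def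
  by (subst apply_Bcontfun_nat[OF norm_rotation_part_coordinate_le]) (rule refl)

lemma norm_rotation_part_le: "norm (rotation_part t y) \<le> 4 * norm y"
  by (rule norm_bound) (simp add: rotation_part_apply norm_rotation_part_coordinate_le)

lemma rotation_part_in_c0: "rotation_part t y \<in> c0"
  unfolding c0_def mem_Collect_eq
proof (rule Lim_null_comparison)
  have "(\<lambda>k. cis (t / real k)) \<longlonglongrightarrow> cis 0"
    by (intro tendsto_cis lim_const_over_n)
  from tendsto_mult_left[OF tendsto_norm[OF tendsto_diff[OF this tendsto_const[of 1]]], of "2 * norm y"]
  show "(\<lambda>k. 2 * norm y * norm (cis (t / real k) - 1)) \<longlonglongrightarrow> 0"
    by simp
  show "\<forall>\<^sub>F k in sequentially. norm (rotation_part t y k) \<le> 2 * norm y * norm (cis (t / real k) - 1)"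
  proof (intro always_eventually allI)
    fix k
    have "norm (y k + y 0) \<le> 2 * norm y"
      using norm_triangle_ineq[of "y k" "y 0"] norm_bounded[of y k] norm_bounded[of y 0] by linarith
    from mult_left_mono[OF this norm_ge_zero[of "cis (t / real k) - 1"]]
    show "norm (rotation_part t y k) \<le> 2 * norm y * norm (cis (t / real k) - 1)"
      by (simp add: rotation_part_apply norm_mult mult_ac)
  qed
qed

lemma rotation_part_add: "rotation_part t (x + y) = rotation_part t x + rotation_part t y"
  by (rule bcontfun_eqI) (simp add: rotation_part_apply algebra_simps)

lemma rotation_part_scaleC: "rotation_part t (c *\<^sub>C y) = c *\<^sub>C rotation_part t y"
  by (rule bcontfun_eqI)
    (simp add: rotation_part_apply apply_bcontfun_scaleC scaleC_complex_def algebra_simps)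

lemma rotation_part_0: "rotation_part 0 y = 0"
  by (rule bcontfun_eqI) (simp add: rotation_part_apply)

text \<open>
  The group law \<open>R\<^bsub>s+t\<^esub> = R\<^sub>s R\<^sub>t\<close>, written for \<open>R\<^sub>t - I\<close>.
\<close>
lemma rotation_part_cocycle:
  "rotation_part (s + t) y = rotation_part t y + rotation_part s (y + rotation_part t y)"
  by (rule bcontfun_eqI)
    (simp add: rotation_part_apply add_divide_distrib cis_mult[symmetric] algebra_simps)

lemma rotation_part_apply_0: "rotation_part t y 0 = 0"
  by (simp add: rotation_part_apply)

lemma cis_inverse_nat_neq_1:
  assumes "0 < k"
  shows "cis (1 / real k) \<noteq> 1"
proof
  assume "cis (1 / real k) = 1"
  then have "sin (1 / real k) = 0"
    by (simp add: complex_eq_iff)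
  moreover have "0 < sin (1 / real k)"
  proof (rule sin_gt_zero)
    have "1 / real k \<le> 1"
      using assms by simp
    then show "1 / real k < pi"
      using pi_gt3 by linarith
  qed (use assms in simp)
  ultimately show False
    by simp
qed

text \<open>
  A convergent sequence fixed by the rotation vanishes in every entry, since no factor is \<open>1\<close>, and
  hence its limit \<open>y 0\<close> is zero.
\<close>
lemma rotation_part_1_eq_0:
  assumes "rotation_part 1 y = 0" "y \<in> c0"
  shows "y 0 = 0"
proof -
  have const: "y k = - y 0" if "0 < k" for k
  proof -
    have "(cis (1 / real k) - 1) * (y k + y 0) = 0"
      using assms(1) rotation_part_apply[of 1 y k] by simp
    then show ?thesis
      using cis_inverse_nat_neq_1[OF that] by (simp add: eq_neg_iff_add_eq_0)
  qed
  have "\<forall>\<^sub>F k in sequentially. y k = - y 0"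
    using eventually_gt_at_top[of 0] by eventually_elim (rule const)
  then have "y \<longlonglongrightarrow> - y 0"
    by (rule tendsto_eventually)
  from LIMSEQ_unique[OF this, of 0] have "- y 0 = 0"
    using assms(2) by (simp add: c0_def)
  then show ?thesis
    by simp
qed

definition unit_seq :: "nat \<Rightarrow> nat \<Rightarrow>\<^sub>C complex" where
  "unit_seq k = Bcontfun (\<lambda>j. if j = k then 1 else 0)"

lemma unit_seq_apply: "unit_seq k j = (if j = k then 1 else 0)"
  unfolding unit_seq_def by (subst apply_Bcontfun_nat[of _ 1]) auto

lemma unit_seq_in_c0: "unit_seq k \<in> c0"
proof -
  have "\<forall>\<^sub>F j in sequentially. unit_seq k j = 0"
    using eventually_gt_at_top[of k] by eventually_elim (simp add: unit_seq_apply)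
  then show ?thesis
    unfolding c0_def mem_Collect_eq by (rule tendsto_eventually)
qed

lemma sum_unit_seq_apply:
  "(\<Sum>k<n. z k *\<^sub>C unit_seq k) j = (if j < n then z j else 0)" for z :: "nat \<Rightarrow> complex"
  by (induction n)
    (auto simp: apply_bcontfun_scaleC scaleC_complex_def unit_seq_apply less_Suc_eq)

lemma sum_unit_seq_tendsto:
  assumes "z \<in> c0"
  shows "(\<lambda>n. \<Sum>k<n. z k *\<^sub>C unit_seq k) \<longlonglongrightarrow> z"
proof (rule tendstoI)
  fix e :: real assume "0 < e"
  then have "\<forall>\<^sub>F j in sequentially. dist (z j) 0 < e/2"
    using assms by (intro tendstoD) (auto simp: c0_def)
  then obtain n0 where n0: "\<And>j. n0 \<le> j \<Longrightarrow> norm (z j) < e/2"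
    by (auto simp: eventually_sequentially)
  show "\<forall>\<^sub>F n in sequentially. dist (\<Sum>k<n. z k *\<^sub>C unit_seq k) z < e"
    using eventually_ge_at_top[of n0]
  proof eventually_elim
    case (elim n)
    have "dist (\<Sum>k<n. z k *\<^sub>C unit_seq k) z \<le> e/2"
      using n0 elim \<open>0 < e\<close> by (intro dist_bound) (auto simp: sum_unit_seq_apply less_imp_le)
    then show ?case
      using \<open>0 < e\<close> by simp
  qed
qed

text \<open>
  With a left inverse \<open>Q\<close> of \<open>f\<close>, the operators \<open>U\<^sub>t = I + f (R\<^sub>t - I) Q\<close> form a uniformly bounded group,
  and \<open>T = U\<^sub>1\<close>. The range of \<open>I - T\<close> consists of vectors \<open>f z\<close> with \<open>z 0 = 0\<close>; such a vector is a limit of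
  finite combinations of eigenvectors with unimodular eigenvalues, so its orbit is relatively
  compact. The functional \<open>x \<mapsto> Q x 0\<close> vanishes on this range and is thus preserved by an ergodic
  projection, but it is zero on fixed vectors.
\<close>
theorem separable_copy_of_c0_counterexample:
  assumes sep: "separable_space (euclidean :: 'a::complex_banach topology)"
    and c0: "contains_copy_of_c0 TYPE('a::complex_banach)"
  obtains T :: "'a::complex_banach \<Rightarrow>\<^sub>L 'a" where "T \<in> bounded_coperators" "doubly_power_bounded T"
    "relatively_compact_orbits_on T (range (blinfun_apply (id_blinfun - T)))" "\<not> mean_ergodic T"
proof -
  obtain f :: "(nat \<Rightarrow>\<^sub>C complex) \<Rightarrow> 'a" and b C where f: "clinear_on c0 f"
    and b: "0 < b" "\<And>a. a \<in> c0 \<Longrightarrow> norm a \<le> b * norm (f a)"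
    and C: "0 < C" "\<And>a. a \<in> c0 \<Longrightarrow> norm (f a) \<le> C * norm a"
    using contains_copy_of_c0E[OF c0] by metis
  obtain Q :: "'a \<Rightarrow> nat \<Rightarrow>\<^sub>C complex" where Q_add: "\<And>x y. Q (x + y) = Q x + Q y"
    and Q_scale: "\<And>c x. Q (c *\<^sub>C x) = c *\<^sub>C Q x" and Q_norm: "\<And>x. norm (Q x) \<le> 4 * b * norm x"
    and Q_c0: "\<And>x. Q x \<in> c0" and Qf: "\<And>a. a \<in> c0 \<Longrightarrow> Q (f a) = a"
    using sobczyk[OF sep f b] by metis
  note f_add = clinear_on_c0D(1)[OF f] and f_scale = clinear_on_c0D(2)[OF f]
    and f_0 = clinear_on_c0D(3)[OF f]
  note c0_part = rotation_part_in_c0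
  define u where "u = (\<lambda>t x. x + f (rotation_part t (Q x)))"
  define B where "B = 1 + C * (4 * (4 * b))"
  have u_add: "u t (x + y) = u t x + u t y" for t x y
    by (simp add: u_def Q_add rotation_part_add f_add c0_part)
  have u_scale: "u t (c *\<^sub>C x) = c *\<^sub>C u t x" for t c x
    by (simp add: u_def Q_scale rotation_part_scaleC f_scale c0_part scaleC_add_right)
  have u_norm: "norm (u t x) \<le> norm x * B" for t x
  proof -
    have "norm (u t x) \<le> norm x + norm (f (rotation_part t (Q x)))"
      unfolding u_def by (rule norm_triangle_ineq)
    also have "norm (f (rotation_part t (Q x))) \<le> C * norm (rotation_part t (Q x))"
      by (rule C(2)[OF c0_part])
    also have "\<dots> \<le> C * (4 * norm (Q x))"
      using C(1) by (intro mult_left_mono norm_rotation_part_le) auto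
    also have "\<dots> \<le> C * (4 * (4 * b * norm x))"
      using C(1) by (intro mult_left_mono Q_norm) auto
    finally show ?thesis
      by (simp add: B_def algebra_simps)
  qed
  have "bounded_linear (u t)" for t
    by (rule bounded_linear_intro[where K = B]) (simp_all add: u_add u_norm u_scale scaleR_scaleC)
  define U where "U = (\<lambda>t. Blinfun (u t))"
  have U: "blinfun_apply (U t) = u t" for t
    unfolding U_def using \<open>bounded_linear (u t)\<close> by (rule bounded_linear_Blinfun_apply)
  have u_u: "u s (u t x) = u (s + t) x" for s t x
    by (simp add: u_def Q_add Qf c0_part rotation_part_cocycle f_add add.assoc)
  have u_0: "u 0 x = x" for x
    by (simp add: u_def rotation_part_0 f_0)
  have pow: "blinfun_pow (U t) n = U (real n * t)" for t n
  proof (rule blinfun_eqI)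
    fix x
    show "blinfun_pow (U t) n x = U (real n * t) x"
      by (induction n) (simp_all add: U u_0 blinfun_pow_Suc_apply u_u distrib_right)
  qed
  have U_op: "U t \<in> bounded_coperators" for t
    by (simp add: bounded_coperators_def U u_scale)
  have U_pb: "power_bounded (U t)" for t
  proof -
    have "norm (blinfun_pow (U t) n) \<le> B" for n
      unfolding pow
      by (rule norm_blinfun_bound) (use b(1) C(1) u_norm in \<open>auto simp: B_def U mult.commute\<close>)
    then show ?thesis
      by (auto simp: power_bounded_def intro!: bdd_aboveI[of _ B])
  qed
  have dpb: "doubly_power_bounded (U 1)"
    unfolding doubly_power_bounded_def
  proof (intro bexI[of _ "U (- 1)"] conjI U_pb U_op)
    show "U 1 o\<^sub>L U (- 1) = id_blinfun" "U (- 1) o\<^sub>L U 1 = id_blinfun"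
      by (rule blinfun_eqI, simp add: U u_u u_0)+
  qed
  have range: "\<exists>z\<in>c0. apply_bcontfun z 0 = 0 \<and> y = f z" if y: "y \<in> range (blinfun_apply (id_blinfun - U 1))" for y
  proof -
    obtain x where x: "y = x - u 1 x"
      using y by (auto simp: blinfun.diff_left U)
    have "y = f ((- 1) *\<^sub>C rotation_part 1 (Q x))"
      by (simp only: f_scale c0_part) (simp add: x u_def)
    then show ?thesis
      using c0_scaleC[OF c0_part, of "- 1"]
      by (intro bexI[of _ "(- 1) *\<^sub>C rotation_part 1 (Q x)"])
        (simp_all add: apply_bcontfun_scaleC scaleC_complex_def rotation_part_apply_0
          del: complex_vector.scale_minus_left)
  qed
  \<comment> \<open>The vectors \<open>f (unit_seq k)\<close> with \<open>k > 0\<close> are eigenvectors, so their orbits stay on a circle.\<close>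
  have rc_unit: "relatively_compact_orbit (U 1) (f (c *\<^sub>C unit_seq k))" if "0 < k" for c k
  proof -
    have "blinfun_pow (U 1) n (f (c *\<^sub>C unit_seq k)) = cis (real n / real k) *\<^sub>C f (c *\<^sub>C unit_seq k)" for n
    proof -
      have mem: "c *\<^sub>C unit_seq k \<in> c0"
        by (intro c0_scaleC unit_seq_in_c0)
      have "c *\<^sub>C unit_seq k + rotation_part (real n) (c *\<^sub>C unit_seq k) = cis (real n / real k) *\<^sub>C c *\<^sub>C unit_seq k"
        using that by (intro bcontfun_eqI)
          (simp add: rotation_part_apply apply_bcontfun_scaleC scaleC_complex_def unit_seq_apply algebra_simps)
      then show ?thesis
        by (simp add: pow U u_def Qf mem c0_part flip: f_add f_scale)
    qed
    then have "range (\<lambda>n. blinfun_pow (U 1) n (f (c *\<^sub>C unit_seq k)))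
        \<subseteq> (\<lambda>a. a *\<^sub>C f (c *\<^sub>C unit_seq k)) ` sphere 0 1" (is "_ \<subseteq> ?S")
      by (auto intro!: imageI)
    moreover have "compact ?S"
    proof (rule compact_continuous_image)
      have "bounded_linear (\<lambda>a. a *\<^sub>C f (c *\<^sub>C unit_seq k))"
        by (rule bounded_linear_intro[where K = "norm (f (c *\<^sub>C unit_seq k))"])
          (simp_all add: scaleC_add_left norm_scaleC scaleR_scaleC scaleC_scaleC scaleC_complex_def)
      then show "continuous_on (sphere 0 1) (\<lambda>a. a *\<^sub>C f (c *\<^sub>C unit_seq k))"
        by (intro linear_continuous_on)
    qed simp
    ultimately show ?thesis
      using compact_Int_closed[of ?S "closure (range (\<lambda>n. blinfun_pow (U 1) n (f (c *\<^sub>C unit_seq k))))"]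
      by (simp add: inf_absorb2 closure_minimal compact_imp_closed)
  qed
  have rc_sum: "(\<Sum>k<n. z k *\<^sub>C unit_seq k) \<in> c0 \<and>
      relatively_compact_orbit (U 1) (f (\<Sum>k<n. z k *\<^sub>C unit_seq k))"
    if "z 0 = 0" for z :: "nat \<Rightarrow> complex" and n
  proof (induction n)
    case 0
    then show ?case
      using relatively_compact_orbit_fixed[of "U 1" 0] zero_in_c0 f_0 by (simp add: blinfun.zero_right)
  next
    case (Suc n)
    have mem: "z n *\<^sub>C unit_seq n \<in> c0"
      by (intro c0_scaleC unit_seq_in_c0)
    have "relatively_compact_orbit (U 1) (f (z n *\<^sub>C unit_seq n))"
    proof (cases "n = 0")
      case True
      then show ?thesis
        using relatively_compact_orbit_fixed[of "U 1" 0] that f_0 by (simp add: blinfun.zero_right)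
    qed (simp add: rc_unit)
    from relatively_compact_orbit_add[OF conjunct2[OF Suc.IH] this] show ?case
      using Suc.IH c0_add mem by (simp add: f_add)
  qed
  have rc: "relatively_compact_orbits_on (U 1) (range (blinfun_apply (id_blinfun - U 1)))"
    unfolding relatively_compact_orbits_on_def
  proof
    fix y assume "y \<in> range (blinfun_apply (id_blinfun - U 1))"
    then obtain z where z: "z \<in> c0" "apply_bcontfun z 0 = 0" "y = f z"
      using range by blast
    define s where "s = (\<lambda>n. \<Sum>k<n. z k *\<^sub>C unit_seq k)"
    have s: "s n \<in> c0" "relatively_compact_orbit (U 1) (f (s n))" for n
      using rc_sum[of "apply_bcontfun z", OF z(2)] by (simp_all add: s_def)
    have "(\<lambda>n. f (s n)) \<longlonglongrightarrow> f z"
    proof (rule Lim_transform2[OF tendsto_const])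
      have diff: "f (s n) = f z + f (s n + (- 1) *\<^sub>C z)" for n
      proof -
        have "f z + f (s n + (- 1) *\<^sub>C z) = f (z + (s n + (- 1) *\<^sub>C z))"
          by (rule f_add[symmetric]) (intro z(1) c0_add c0_scaleC s(1))+
        then show ?thesis
          by simp
      qed
      show "(\<lambda>n. f z - f (s n)) \<longlonglongrightarrow> 0"
      proof (rule Lim_null_comparison)
        have "norm (f (s n + (- 1) *\<^sub>C z)) \<le> C * norm (s n + (- 1) *\<^sub>C z)" for n
          by (intro C(2) c0_add c0_scaleC s z)
        then show "\<forall>\<^sub>F n in sequentially. norm (f z - f (s n)) \<le> C * dist (s n) z"
          unfolding diff by (simp add: dist_norm)
        show "(\<lambda>n. C * dist (s n) z) \<longlonglongrightarrow> 0"
          using tendsto_mult_left[OF tendsto_dist[OF sum_unit_seq_tendsto[OF z(1)] tendsto_const[of z]], of C]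
          by (simp add: s_def)
      qed
    qed
    then have "f z \<in> closure (range (\<lambda>n. f (s n)))"
      unfolding closure_sequential by (intro exI[of _ "\<lambda>n. f (s n)"]) simp
    then show "relatively_compact_orbit (U 1) y"
      unfolding z(3) by (rule relatively_compact_orbit_closure[OF U_pb, rotated]) (use s(2) in blast)
  qed
  have "\<not> mean_ergodic (U 1)"
  proof
    assume "mean_ergodic (U 1)"
    then obtain P where P: "P \<in> strong_operator_topology closure_of (convex hull (range (blinfun_pow (U 1))))"
      and UP: "U 1 o\<^sub>L P = P"
      by (auto simp: mean_ergodic_def)
    \<comment> \<open>In the encoding by limits, \<open>unit_seq 0\<close> is the constant sequence \<open>1\<close>.\<close>
    define e where "e = f (unit_seq 0)"
    have "U 1 (P e) = P e"
      using UP by (metis blinfun_apply_blinfun_compose)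
    then have "f (rotation_part 1 (Q (P e))) = 0"
      by (simp add: U u_def)
    then have "rotation_part 1 (Q (P e)) = 0"
      using b(2)[OF c0_part, of 1 "Q (P e)"] by simp
    then have "Q (P e) 0 = 0"
      by (rule rotation_part_1_eq_0[OF _ Q_c0])
    have "bounded_linear (\<lambda>x. Q x 0)"
    proof (rule bounded_linear_intro)
      show "norm (Q x 0) \<le> norm x * (4 * b)" for x
        using norm_bounded[of "Q x" 0] Q_norm[of x] by (simp add: mult.commute)
    qed (simp_all add: Q_add scaleR_scaleC Q_scale apply_bcontfun_scaleC)
    then have "continuous_on UNIV (\<lambda>x. Q x 0)"
      by (rule linear_continuous_on)
    then have "closed {x. Q x 0 = 0}"
      using continuous_closed_vimage[of "{0}" "\<lambda>x. Q x 0"]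
      by (simp add: continuous_on_eq_continuous_at vimage_def)
    moreover have "range (blinfun_apply (id_blinfun - U 1)) \<subseteq> {x. Q x 0 = 0}"
      using range Qf by (metis (mono_tags, lifting) mem_Collect_eq subsetI)
    ultimately have "e - P e \<in> {x. Q x 0 = 0}"
      using diff_strong_closure_hull_pow_in_closure_range[OF P, of e] closure_minimal by blast
    moreover have "Q e = Q (e - P e) + Q (P e)"
      by (simp flip: Q_add)
    ultimately have "Q e 0 = 0"
      using \<open>Q (P e) 0 = 0\<close> by simp
    then show False
      by (simp add: e_def Qf unit_seq_in_c0 unit_seq_apply)
  qed
  then show thesis
    using that[of "U 1"] U_op dpb rc by blast
qed

section \<open>The equivalences\<close>

theorem theorem4p1:
  shows "let
      a = (\<not> contains_copy_of_c0 TYPE('a::complex_banach));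
      b = (\<forall>T\<in>(bounded_coperators :: ('a \<Rightarrow>\<^sub>L 'a) set).
             power_bounded T \<and> power_bounded_below T \<and>
             relatively_compact_orbits_on T (range (blinfun_apply (id_blinfun - T))) \<longrightarrow>
             relatively_compact_orbits_on T UNIV);
      c = (\<forall>T\<in>(bounded_coperators :: ('a \<Rightarrow>\<^sub>L 'a) set).
             power_bounded T \<and> power_bounded_below T \<and>
             relatively_compact_orbits_on T (range (blinfun_apply (id_blinfun - T))) \<longrightarrow>
             mean_ergodic T);
      d = (\<forall>T\<in>(bounded_coperators :: ('a \<Rightarrow>\<^sub>L 'a) set).
             doubly_power_bounded T \<and>
             relatively_compact_orbits_on T (range (blinfun_apply (id_blinfun - T))) \<longrightarrow>
             relatively_compact_orbits_on T UNIV);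
      e = (\<forall>T\<in>(bounded_coperators :: ('a \<Rightarrow>\<^sub>L 'a) set).
             doubly_power_bounded T \<and>
             relatively_compact_orbits_on T (range (blinfun_apply (id_blinfun - T))) \<longrightarrow>
             mean_ergodic T)
    in (a \<longrightarrow> b) \<and> (b \<longleftrightarrow> c) \<and> (c \<longrightarrow> d) \<and> (d \<longleftrightarrow> e) \<and>
       (separable_space (euclidean :: 'a topology) \<longrightarrow>
         (a \<longleftrightarrow> b) \<and> (a \<longleftrightarrow> c) \<and> (a \<longleftrightarrow> d) \<and> (a \<longleftrightarrow> e))"
proof -
  define rg where
    "rg = (\<lambda>T :: 'a \<Rightarrow>\<^sub>L 'a. relatively_compact_orbits_on T (range (blinfun_apply (id_blinfun - T))))"
  have iff: "relatively_compact_orbits_on T UNIV \<longleftrightarrow> mean_ergodic T"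
    if "T \<in> bounded_coperators" "power_bounded T" "rg T" for T :: "'a \<Rightarrow>\<^sub>L 'a"
    using that relatively_compact_orbits_if_mean_ergodic mean_ergodic_if_relatively_compact_orbits
    unfolding rg_def by blast
  have ab: "relatively_compact_orbits_on T UNIV"
    if "\<not> contains_copy_of_c0 TYPE('a)" "power_bounded T" "power_bounded_below T" "rg T"
    for T :: "'a \<Rightarrow>\<^sub>L 'a"
    using that contains_copy_of_c0_if_orbit_not_relatively_compact[of T]
    unfolding relatively_compact_orbits_on_def[of T UNIV] rg_def by blast
  have ea: "\<exists>T :: 'a \<Rightarrow>\<^sub>L 'a. T \<in> bounded_coperators \<and> doubly_power_bounded T \<and> rg T \<and> \<not> mean_ergodic T"
    if "separable_space (euclidean :: 'a topology)" "contains_copy_of_c0 TYPE('a)"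
    using separable_copy_of_c0_counterexample[OF that] unfolding rg_def by blast
  have rg: "relatively_compact_orbits_on T (range (blinfun_apply (id_blinfun - T))) \<longleftrightarrow> rg T"
    for T :: "'a \<Rightarrow>\<^sub>L 'a"
    by (simp add: rg_def)
  have bc: "power_bounded T \<and> power_bounded_below T \<and> rg T \<longrightarrow>
      relatively_compact_orbits_on T UNIV \<longleftrightarrow> mean_ergodic T"
    and de: "doubly_power_bounded T \<and> rg T \<longrightarrow>
      relatively_compact_orbits_on T UNIV \<longleftrightarrow> mean_ergodic T"
    if "T \<in> bounded_coperators" for T :: "'a \<Rightarrow>\<^sub>L 'a"
    using iff[OF that] doubly_power_bounded_imp(1) by blast+
  show ?thesis
    unfolding Let_def rg
  proof (intro conjI impI)
  qed (use ab ea bc de doubly_power_bounded_imp in blast)+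
qed

end
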